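(* Let $\mathsf{C}$ be a category with covers (satisfying the axioms (A1)–(A4) of the context), let $n\ge1$, and let $G_\bullet$ be a strict Lie $n$-group in $\mathsf{C}$. Then the simplicial object underlying $G_\bullet$ is a Lie $(n-1)$-groupoid.
   Context: **Categories with covers.** $\mathsf{C}$ is a category with a subcategory of morphisms called covers such that: (A1) $\mathsf{C}$ has a terminal object $\ast$ and $X\to\ast$ is a cover for every $X$; (A2) pullbacks of covers along arbitrary maps exist and are covers; (A3) if $g,f$ are composable and $f\circ g$ and $g$ are covers, then $f$ is a cover; (A4) every cover is an effective epimorphism (the coequalizer of its kernel pair). **Notation.** For a simplicial object $X_\bullet$ in $\mathsf{C}$ and a simplicial set $S$, $\hom(S,X):=\lim_{\Delta^k\to S}X_k$, if it exists. $\Lambda^k_i\subset\partial\Delta^k$ is the horn omitting the $i$-th face; $\Lambda^k_i(X):=\hom(\Lambda^k_i,X)$, with induced map $\lambda^k_i(X)\colon X_k\to\Lambda^k_i(X)$. For $m\in\mathbb N\cup\{\infty\}$, a Lie $m$-groupoid is a simplicial object $X_\bullet$ in $\mathsf{C}$ such that for all $k>0$ and $0\le i\le k$, $\Lambda^k_i(X)$ exists in $\mathsf{C}$ and $\lambda^k_i(X)$ is a cover, and is an isomorphism for $k>m$. A simplicial Lie group is a simplicial object in the category of group objects of $\mathsf{C}$. A strict Lie $n$-group is a simplicial Lie group $G_\bullet$ such that the horn-filling maps $\lambda^k_i(G)$ of the underlying simplicial object are isomorphisms for $k\ge n$ (no condition is imposed for $k<n$). *)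

theory Defs
  imports Main "HOL-Library.FuncSet" "HOL-Library.Extended_Nat"
begin

section \<open>Categories and functors\<close>

record ('o, 'a) cat =
  Obj :: "'o set"
  Arr :: "'a set"
  Dom :: "'a \<Rightarrow> 'o"
  Cod :: "'a \<Rightarrow> 'o"
  Id :: "'o \<Rightarrow> 'a"
  Comp :: "'a \<Rightarrow> 'a \<Rightarrow> 'a"  \<comment> \<open>applicative order: \<open>Comp C g f\<close> is \<open>g \<circ> f\<close>\<close>

definition hom :: "('o, 'a) cat \<Rightarrow> 'o \<Rightarrow> 'o \<Rightarrow> 'a set" where
  "hom C A B = {f \<in> Arr C. Dom C f = A \<and> Cod C f = B}"

locale category =
  fixes C :: "('o, 'a) cat"
  assumes Dom_Obj: "f \<in> Arr C \<Longrightarrow> Dom C f \<in> Obj C"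
    and Cod_Obj: "f \<in> Arr C \<Longrightarrow> Cod C f \<in> Obj C"
    and Id_hom: "A \<in> Obj C \<Longrightarrow> Id C A \<in> hom C A A"
    and Comp_hom: "f \<in> hom C A B \<Longrightarrow> g \<in> hom C B D \<Longrightarrow> Comp C g f \<in> hom C A D"
    and Comp_Id: "f \<in> hom C A B \<Longrightarrow> Comp C f (Id C A) = f"
    and Id_Comp: "f \<in> hom C A B \<Longrightarrow> Comp C (Id C B) f = f"
    and Comp_assoc: "f \<in> hom C A B \<Longrightarrow> g \<in> hom C B D \<Longrightarrow> h \<in> hom C D E \<Longrightarrow>
      Comp C h (Comp C g f) = Comp C (Comp C h g) f"

definition op_cat :: "('o, 'a) cat \<Rightarrow> ('o, 'a) cat" where
  "op_cat C = \<lparr>Obj = Obj C, Arr = Arr C, Dom = Cod C, Cod = Dom C, Id = Id C,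
     Comp = (\<lambda>g f. Comp C f g)\<rparr>"

definition iso :: "('o, 'a) cat \<Rightarrow> 'a \<Rightarrow> bool" where
  "iso C f \<longleftrightarrow> f \<in> Arr C \<and>
     (\<exists>g \<in> hom C (Cod C f) (Dom C f).
        Comp C g f = Id C (Dom C f) \<and> Comp C f g = Id C (Cod C f))"

record ('o, 'a, 'p, 'b) ftor =
  omap :: "'o \<Rightarrow> 'p"
  amap :: "'a \<Rightarrow> 'b"

definition is_functor ::
  "('o, 'a) cat \<Rightarrow> ('p, 'b) cat \<Rightarrow> ('o, 'a, 'p, 'b) ftor \<Rightarrow> bool" where
  "is_functor C D F \<longleftrightarrow>
     (\<forall>A \<in> Obj C. omap F A \<in> Obj D) \<and>
     (\<forall>f \<in> Arr C. amap F f \<in> hom D (omap F (Dom C f)) (omap F (Cod C f))) \<and>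
     (\<forall>A \<in> Obj C. amap F (Id C A) = Id D (omap F A)) \<and>
     (\<forall>f \<in> Arr C. \<forall>g \<in> Arr C. Cod C f = Dom C g \<longrightarrow>
        amap F (Comp C g f) = Comp D (amap F g) (amap F f))"

definition comp_ftor ::
  "('p, 'b, 'q, 'c) ftor \<Rightarrow> ('o, 'a, 'p, 'b) ftor \<Rightarrow> ('o, 'a, 'q, 'c) ftor" where
  "comp_ftor G F = \<lparr>omap = omap G \<circ> omap F, amap = amap G \<circ> amap F\<rparr>"


section \<open>Limits and colimits\<close>

definition is_cone :: "('j, 'u) cat \<Rightarrow> ('o, 'a) cat \<Rightarrow> ('j, 'u, 'o, 'a) ftor \<Rightarrow>
    'o \<Rightarrow> ('j \<Rightarrow> 'a) \<Rightarrow> bool" where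
  "is_cone J C D L p \<longleftrightarrow> L \<in> Obj C \<and>
     (\<forall>j \<in> Obj J. p j \<in> hom C L (omap D j)) \<and>
     (\<forall>u \<in> Arr J. Comp C (amap D u) (p (Dom J u)) = p (Cod J u))"

definition is_limit :: "('j, 'u) cat \<Rightarrow> ('o, 'a) cat \<Rightarrow> ('j, 'u, 'o, 'a) ftor \<Rightarrow>
    'o \<Rightarrow> ('j \<Rightarrow> 'a) \<Rightarrow> bool" where
  "is_limit J C D L p \<longleftrightarrow> is_cone J C D L p \<and>
     (\<forall>M q. is_cone J C D M q \<longrightarrow>
        (\<exists>!u. u \<in> hom C M L \<and> (\<forall>j \<in> Obj J. Comp C (p j) u = q j)))"

definition mediating :: "('j, 'u) cat \<Rightarrow> ('o, 'a) cat \<Rightarrow>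
    'o \<Rightarrow> ('j \<Rightarrow> 'a) \<Rightarrow> 'o \<Rightarrow> ('j \<Rightarrow> 'a) \<Rightarrow> 'a" where
  "mediating J C L p M q =
     (THE u. u \<in> hom C M L \<and> (\<forall>j \<in> Obj J. Comp C (p j) u = q j))"

definition is_terminal :: "('o, 'a) cat \<Rightarrow> 'o \<Rightarrow> bool" where
  "is_terminal C T \<longleftrightarrow> T \<in> Obj C \<and> (\<forall>A \<in> Obj C. \<exists>!f. f \<in> hom C A T)"

definition is_product :: "('o, 'a) cat \<Rightarrow> 'o \<Rightarrow> 'o \<Rightarrow> 'o \<Rightarrow> 'a \<Rightarrow> 'a \<Rightarrow> bool" where
  "is_product C A B P p q \<longleftrightarrow> p \<in> hom C P A \<and> q \<in> hom C P B \<and>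
     (\<forall>T. \<forall>a \<in> hom C T A. \<forall>b \<in> hom C T B.
        \<exists>!u. u \<in> hom C T P \<and> Comp C p u = a \<and> Comp C q u = b)"

text \<open>\<open>is_pullback C f g P p q\<close> says that the square \<open>f \<circ> p = g \<circ> q\<close> is cartesian;
  thus \<open>q\<close> is a pullback of \<open>f\<close> along \<open>g\<close>.\<close>

definition is_pullback ::
  "('o, 'a) cat \<Rightarrow> 'a \<Rightarrow> 'a \<Rightarrow> 'o \<Rightarrow> 'a \<Rightarrow> 'a \<Rightarrow> bool" where
  "is_pullback C f g P p q \<longleftrightarrow>
     f \<in> Arr C \<and> g \<in> Arr C \<and> Cod C f = Cod C g \<and>
     p \<in> hom C P (Dom C f) \<and> q \<in> hom C P (Dom C g) \<and> Comp C f p = Comp C g q \<and>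
     (\<forall>T. \<forall>a \<in> hom C T (Dom C f). \<forall>b \<in> hom C T (Dom C g).
        Comp C f a = Comp C g b \<longrightarrow>
        (\<exists>!u. u \<in> hom C T P \<and> Comp C p u = a \<and> Comp C q u = b))"

definition is_coequalizer :: "('o, 'a) cat \<Rightarrow> 'a \<Rightarrow> 'a \<Rightarrow> 'a \<Rightarrow> bool" where
  "is_coequalizer C p q f \<longleftrightarrow>
     p \<in> Arr C \<and> q \<in> Arr C \<and> f \<in> Arr C \<and>
     Dom C p = Dom C q \<and> Cod C p = Dom C f \<and> Cod C q = Dom C f \<and>
     Comp C f p = Comp C f q \<and>
     (\<forall>Z. \<forall>h \<in> hom C (Dom C f) Z. Comp C h p = Comp C h q \<longrightarrow>
        (\<exists>!u. u \<in> hom C (Cod C f) Z \<and> Comp C u f = h))"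

definition effective_epi :: "('o, 'a) cat \<Rightarrow> 'a \<Rightarrow> bool" where
  "effective_epi C f \<longleftrightarrow>
     (\<exists>P p q. is_pullback C f f P p q \<and> is_coequalizer C p q f)"


section \<open>Categories with covers\<close>

text \<open>The subcategory of covers is given by its set of arrows \<open>Cov\<close>; its objects are
  the sources and targets of covers, which by \<open>terminal_cover\<close> are all objects.\<close>

locale category_with_covers = category C
  for C :: "('o, 'a) cat" +
  fixes Cov :: "'a set"
  assumes Cov_Arr: "Cov \<subseteq> Arr C"
    and Cov_Id: "f \<in> Cov \<Longrightarrow> Id C (Dom C f) \<in> Cov \<and> Id C (Cod C f) \<in> Cov"
    and Cov_Comp: "f \<in> Cov \<Longrightarrow> g \<in> Cov \<Longrightarrow> Cod C f = Dom C g \<Longrightarrow> Comp C g f \<in> Cov"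
    and terminal_cover:
      "\<exists>T. is_terminal C T \<and> (\<forall>X \<in> Obj C. \<forall>f \<in> hom C X T. f \<in> Cov)"
    and pullback_exists: "f \<in> Cov \<Longrightarrow> g \<in> Arr C \<Longrightarrow> Cod C f = Cod C g \<Longrightarrow>
      \<exists>P p q. is_pullback C f g P p q"
    and pullback_cover: "f \<in> Cov \<Longrightarrow> is_pullback C f g P p q \<Longrightarrow> q \<in> Cov"
    and cover_cancel: "g \<in> Arr C \<Longrightarrow> f \<in> Arr C \<Longrightarrow> Cod C g = Dom C f \<Longrightarrow>
      Comp C f g \<in> Cov \<Longrightarrow> g \<in> Cov \<Longrightarrow> f \<in> Cov"
    and cover_effective_epi: "f \<in> Cov \<Longrightarrow> effective_epi C f"


section \<open>Simplicial objects and simplicial sets\<close>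

text \<open>The object \<open>m\<close> of \<open>Delta\<close> is the ordinal \<open>[m] = {0, \<dots>, m}\<close>. Arrows are triples
  \<open>(m, n, f)\<close> with \<open>f\<close> extensional, so that equality of arrows is equality of maps.\<close>

type_synonym delta_arr = "nat \<times> nat \<times> (nat \<Rightarrow> nat)"

definition Delta :: "(nat, delta_arr) cat" where
  "Delta = \<lparr>Obj = UNIV,
     Arr = {(m, n, f). f \<in> {..m} \<rightarrow>\<^sub>E {..n} \<and> mono_on {..m} f},
     Dom = (\<lambda>(m, n, f). m),
     Cod = (\<lambda>(m, n, f). n),
     Id = (\<lambda>n. (n, n, \<lambda>x\<in>{..n}. x)),
     Comp = (\<lambda>(_, n, g) (m, _, f). (m, n, compose {..m} g f))\<rparr>"

definition Set :: "('e set, 'e set \<times> 'e set \<times> ('e \<Rightarrow> 'e)) cat" where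
  "Set = \<lparr>Obj = UNIV,
     Arr = {(A, B, f). f \<in> A \<rightarrow>\<^sub>E B},
     Dom = (\<lambda>(A, B, f). A),
     Cod = (\<lambda>(A, B, f). B),
     Id = (\<lambda>A. (A, A, \<lambda>x\<in>A. x)),
     Comp = (\<lambda>(_, B, g) (A, _, f). (A, B, compose A g f))\<rparr>"

type_synonym ('o, 'a) sobj = "(nat, delta_arr, 'o, 'a) ftor"
type_synonym 'e sset = "('e set, 'e set \<times> 'e set \<times> ('e \<Rightarrow> 'e)) sobj"

definition simplicial_object :: "('o, 'a) cat \<Rightarrow> ('o, 'a) sobj \<Rightarrow> bool" where
  "simplicial_object C X \<longleftrightarrow> is_functor (op_cat Delta) C X"

text \<open>The category of simplices of a simplicial set \<open>S\<close>. An object \<open>(k, s)\<close> with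
  \<open>s \<in> S\<^sub>k\<close> stands for the map \<open>\<Delta>\<^sup>k \<rightarrow> S\<close> classifying \<open>s\<close>, and an arrow
  \<open>(k, s) \<rightarrow> (l, t)\<close> is a map \<open>\<theta> : [k] \<rightarrow> [l]\<close> such that \<open>\<theta>\<close> pulls \<open>t\<close> back to \<open>s\<close>.\<close>

definition simplices ::
  "'e sset \<Rightarrow> (nat \<times> 'e, (nat \<times> 'e) \<times> delta_arr \<times> (nat \<times> 'e)) cat" where
  "simplices S = \<lparr>Obj = {(k, s). s \<in> omap S k},
     Arr = {((k, s), \<theta>, (l, t)). s \<in> omap S k \<and> t \<in> omap S l \<and>
              \<theta> \<in> hom Delta k l \<and> snd (snd (amap S \<theta>)) t = s},
     Dom = (\<lambda>(x, \<theta>, y). x),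
     Cod = (\<lambda>(x, \<theta>, y). y),
     Id = (\<lambda>x. (x, Id Delta (fst x), x)),
     Comp = (\<lambda>(_, \<eta>, z) (x, \<theta>, _). (x, Comp Delta \<eta> \<theta>, z))\<rparr>"

definition simplices_diagram :: "('o, 'a) sobj \<Rightarrow>
    (nat \<times> 'e, (nat \<times> 'e) \<times> delta_arr \<times> (nat \<times> 'e), 'o, 'a) ftor" where
  "simplices_diagram X = \<lparr>omap = (\<lambda>(k, s). omap X k), amap = (\<lambda>(x, \<theta>, y). amap X \<theta>)\<rparr>"

text \<open>\<open>(L, p)\<close> is a limit of \<open>X\<^sub>k\<close> over all \<open>\<Delta>\<^sup>k \<rightarrow> S\<close>, i.e. it represents \<open>hom(S, X)\<close>.\<close>

definition is_hom_object :: "('o, 'a) cat \<Rightarrow> 'e sset \<Rightarrow> ('o, 'a) sobj \<Rightarrow>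
    'o \<Rightarrow> (nat \<times> 'e \<Rightarrow> 'a) \<Rightarrow> bool" where
  "is_hom_object C S X L p \<longleftrightarrow>
     is_limit (op_cat (simplices S)) C (simplices_diagram X) L p"


section \<open>Horns\<close>

text \<open>The union of the faces \<open>j \<noteq> i\<close> of \<open>\<Delta>\<^sup>k\<close>: an \<open>m\<close>-simplex \<open>[m] \<rightarrow> [k]\<close> lies in the
  \<open>j\<close>-th face iff its image misses \<open>j\<close>.\<close>

definition horn_simplices :: "nat \<Rightarrow> nat \<Rightarrow> nat \<Rightarrow> delta_arr set" where
  "horn_simplices k i m =
     {\<sigma> \<in> hom Delta m k. \<exists>j \<le> k. j \<noteq> i \<and> j \<notin> snd (snd \<sigma>) ` {..m}}"

definition horn :: "nat \<Rightarrow> nat \<Rightarrow> delta_arr sset" where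
  "horn k i = \<lparr>omap = horn_simplices k i,
     amap = (\<lambda>\<theta>. (horn_simplices k i (Cod Delta \<theta>), horn_simplices k i (Dom Delta \<theta>),
        \<lambda>\<sigma>\<in>horn_simplices k i (Cod Delta \<theta>). Comp Delta \<sigma> \<theta>))\<rparr>"

definition is_horn_object :: "('o, 'a) cat \<Rightarrow> ('o, 'a) sobj \<Rightarrow> nat \<Rightarrow> nat \<Rightarrow>
    'o \<Rightarrow> (nat \<times> delta_arr \<Rightarrow> 'a) \<Rightarrow> bool" where
  "is_horn_object C X k i L p \<longleftrightarrow> is_hom_object C (horn k i) X L p"

text \<open>The map \<open>X\<^sub>k = hom(\<Delta>\<^sup>k, X) \<rightarrow> L\<close> induced by the inclusion of the horn: its component
  at a simplex \<open>\<sigma> : [m] \<rightarrow> [k]\<close> of the horn is \<open>X(\<sigma>) : X\<^sub>k \<rightarrow> X\<^sub>m\<close>.\<close>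

definition horn_map :: "('o, 'a) cat \<Rightarrow> ('o, 'a) sobj \<Rightarrow> nat \<Rightarrow> nat \<Rightarrow>
    'o \<Rightarrow> (nat \<times> delta_arr \<Rightarrow> 'a) \<Rightarrow> 'a" where
  "horn_map C X k i L p =
     mediating (op_cat (simplices (horn k i))) C L p (omap X k) (\<lambda>(m, \<sigma>). amap X \<sigma>)"

text \<open>Limits are unique up to unique isomorphism, and isomorphisms are covers (they are
  pullbacks of identities). Hence for the conditions below it is immaterial which limit
  represents the horn space.\<close>

definition lie_groupoid :: "('o, 'a) cat \<Rightarrow> 'a set \<Rightarrow> enat \<Rightarrow> ('o, 'a) sobj \<Rightarrow> bool" where
  "lie_groupoid C Cov m X \<longleftrightarrow> simplicial_object C X \<and>
     (\<forall>k > 0. \<forall>i \<le> k.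
        (\<exists>L p. is_horn_object C X k i L p) \<and>
        (\<forall>L p. is_horn_object C X k i L p \<longrightarrow>
           horn_map C X k i L p \<in> Cov \<and> (enat k > m \<longrightarrow> iso C (horn_map C X k i L p))))"


section \<open>Group objects and strict Lie groups\<close>

definition terminal_obj :: "('o, 'a) cat \<Rightarrow> 'o" where
  "terminal_obj C = (SOME T. is_terminal C T)"

definition to_terminal :: "('o, 'a) cat \<Rightarrow> 'o \<Rightarrow> 'a" where
  "to_terminal C A = (THE f. f \<in> hom C A (terminal_obj C))"

definition product_cone :: "('o, 'a) cat \<Rightarrow> 'o \<Rightarrow> 'o \<Rightarrow> 'o \<times> 'a \<times> 'a" where
  "product_cone C A B = (SOME (P, p, q). is_product C A B P p q)"

definition product_obj :: "('o, 'a) cat \<Rightarrow> 'o \<Rightarrow> 'o \<Rightarrow> 'o" where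
  "product_obj C A B = fst (product_cone C A B)"

definition proj1 :: "('o, 'a) cat \<Rightarrow> 'o \<Rightarrow> 'o \<Rightarrow> 'a" where
  "proj1 C A B = fst (snd (product_cone C A B))"

definition proj2 :: "('o, 'a) cat \<Rightarrow> 'o \<Rightarrow> 'o \<Rightarrow> 'a" where
  "proj2 C A B = snd (snd (product_cone C A B))"

definition pairing :: "('o, 'a) cat \<Rightarrow> 'a \<Rightarrow> 'a \<Rightarrow> 'a" where
  "pairing C f g = (THE u. u \<in> hom C (Dom C f) (product_obj C (Cod C f) (Cod C g)) \<and>
     Comp C (proj1 C (Cod C f) (Cod C g)) u = f \<and>
     Comp C (proj2 C (Cod C f) (Cod C g)) u = g)"

record ('o, 'a) group_data =
  carr :: 'o
  mult :: 'a
  unt :: 'a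
  invs :: 'a

definition group_object :: "('o, 'a) cat \<Rightarrow> ('o, 'a) group_data \<Rightarrow> bool" where
  "group_object C G \<longleftrightarrow>
    (let A = carr G; m = mult G; e = unt G; v = invs G;
         AA = product_obj C A A;
         e' = Comp C e (to_terminal C A);
         x = Comp C (proj1 C A A) (proj1 C AA A);
         y = Comp C (proj2 C A A) (proj1 C AA A);
         z = proj2 C AA A
     in A \<in> Obj C \<and> m \<in> hom C AA A \<and> e \<in> hom C (terminal_obj C) A \<and> v \<in> hom C A A \<and>
        Comp C m (pairing C (Comp C m (pairing C x y)) z) =
          Comp C m (pairing C x (Comp C m (pairing C y z))) \<and>
        Comp C m (pairing C e' (Id C A)) = Id C A \<and>
        Comp C m (pairing C (Id C A) e') = Id C A \<and>
        Comp C m (pairing C v (Id C A)) = e' \<and>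
        Comp C m (pairing C (Id C A) v) = e')"

definition group_hom ::
  "('o, 'a) cat \<Rightarrow> ('o, 'a) group_data \<Rightarrow> ('o, 'a) group_data \<Rightarrow> 'a \<Rightarrow> bool" where
  "group_hom C G H f \<longleftrightarrow> f \<in> hom C (carr G) (carr H) \<and>
     Comp C f (mult G) =
       Comp C (mult H) (pairing C (Comp C f (proj1 C (carr G) (carr G)))
                                  (Comp C f (proj2 C (carr G) (carr G))))"

type_synonym ('o, 'a) group_arr = "('o, 'a) group_data \<times> ('o, 'a) group_data \<times> 'a"

definition Grp :: "('o, 'a) cat \<Rightarrow> (('o, 'a) group_data, ('o, 'a) group_arr) cat" where
  "Grp C = \<lparr>Obj = {G. group_object C G},
     Arr = {(G, H, f). group_object C G \<and> group_object C H \<and> group_hom C G H f},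
     Dom = (\<lambda>(G, H, f). G),
     Cod = (\<lambda>(G, H, f). H),
     Id = (\<lambda>G. (G, G, Id C (carr G))),
     Comp = (\<lambda>(_, K, g) (G, _, f). (G, K, Comp C g f))\<rparr>"

definition forget :: "(('o, 'a) group_data, ('o, 'a) group_arr, 'o, 'a) ftor" where
  "forget = \<lparr>omap = carr, amap = (\<lambda>(G, H, f). f)\<rparr>"

type_synonym ('o, 'a) sgrp = "(('o, 'a) group_data, ('o, 'a) group_arr) sobj"

definition simplicial_lie_group :: "('o, 'a) cat \<Rightarrow> ('o, 'a) sgrp \<Rightarrow> bool" where
  "simplicial_lie_group C G \<longleftrightarrow> simplicial_object (Grp C) G"

definition underlying :: "('o, 'a) sgrp \<Rightarrow> ('o, 'a) sobj" where
  "underlying G = comp_ftor forget G"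

definition strict_lie_group :: "('o, 'a) cat \<Rightarrow> nat \<Rightarrow> ('o, 'a) sgrp \<Rightarrow> bool" where
  "strict_lie_group C n G \<longleftrightarrow> simplicial_lie_group C G \<and>
     (\<forall>k \<ge> n. \<forall>i \<le> k.
        (\<exists>L p. is_horn_object C (underlying G) k i L p) \<and>
        (\<forall>L p. is_horn_object C (underlying G) k i L p \<longrightarrow>
           iso C (horn_map C (underlying G) k i L p)))"

end

theory Submission
  imports Defs
begin

text \<open>
  Everything happens on \<open>T\<close>-points: the arrows from \<open>T\<close> into the objects \<open>G\<^sub>k\<close> form a simplicial
  group, naturally in \<open>T\<close>. Call the union of the faces \<open>j \<in> J\<close> of \<open>\<Delta>\<^sup>k\<close> a partial boundary if
  \<open>J\<close> is a proper subset of \<open>{0, \<dots>, k}\<close>; horns are partial boundaries. Three facts about them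
  carry the proof.

  First, Moore's argument (\<open>filler_exists\<close>): a compatible family of points on a partial boundary
  extends to \<open>\<Delta>\<^sup>k\<close>. The extension is built one face at a time by multiplying with a correction
  term. Applied to the universal family, it shows that the restriction \<open>G\<^sub>k \<rightarrow> L\<close> to an object
  \<open>L\<close> representing the families on the partial boundary has a section.

  Second, this restriction is a cover (\<open>restriction_cover\<close>). A section of a map does not make it
  a cover, but \<open>L\<close> inherits a group structure for which the restriction \<open>h\<close> is a homomorphism.
  With \<open>s\<close> the section, the map \<open>g : G\<^sub>k \<times> L \<rightarrow> G\<^sub>k\<close>, \<open>(x, y) \<mapsto> x \<cdot> s y\<close>, becomes a projection after an
  automorphism of \<open>G\<^sub>k \<times> L\<close>, and so does \<open>h \<circ> g\<close>, which is \<open>(x, y) \<mapsto> h x \<cdot> y\<close>. Projections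
  are covers, being pullbacks of maps to the terminal object, so the
  cancellation axiom for covers makes \<open>h\<close> a cover.

  Third, the representing objects exist (\<open>face_object_exists\<close>), by induction on the dimension and
  on \<open>J\<close>. Adding the face \<open>j\<close> to the partial boundary \<open>J\<close> glues a \<open>(k-1)\<close>-simplex along a
  partial boundary of it, so the new object is a pullback of the restriction map in dimension
  \<open>k - 1\<close>. That map is a cover by the second fact, so the pullback exists.

  Thus all horn objects of a simplicial group object exist and all horn maps are covers, and
  the isomorphism condition of a strict Lie \<open>n\<close>-group in dimensions \<open>k \<ge> n\<close> is the one that a Lie
  \<open>(n-1)\<close>-groupoid asks for.
\<close>

section \<open>Products and points of group objects\<close>

abbreviation (in category) comp (infixr "\<cdot>" 70) where
  "g \<cdot> f \<equiv> Comp C g f"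

lemma homD: "f \<in> hom C A B \<Longrightarrow> f \<in> Arr C \<and> Dom C f = A \<and> Cod C f = B"
  by (simp add: hom_def)

lemma (in category) hom_objs: "f \<in> hom C A B \<Longrightarrow> A \<in> Obj C \<and> B \<in> Obj C"
  using Dom_Obj Cod_Obj by (auto simp: hom_def)

context category_with_covers
begin

lemma terminal_obj: "is_terminal C (terminal_obj C)"
  using terminal_cover unfolding terminal_obj_def by (metis someI_ex)

lemma to_terminal_hom: "A \<in> Obj C \<Longrightarrow> to_terminal C A \<in> hom C A (terminal_obj C)"
  using terminal_obj unfolding is_terminal_def to_terminal_def by (metis theI')

lemma to_terminal_unique:
  "f \<in> hom C A (terminal_obj C) \<Longrightarrow> g \<in> hom C A (terminal_obj C) \<Longrightarrow> f = g"
  using terminal_obj hom_objs unfolding is_terminal_def by blast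

lemma product_is_pullback:
  assumes "is_terminal C T" "f \<in> hom C A T" "g \<in> hom C B T"
  shows "is_product C A B P p q \<longleftrightarrow> is_pullback C f g P p q"
proof -
  have eq: "f \<cdot> a = g \<cdot> b" if "a \<in> hom C S A" "b \<in> hom C S B" for S a b
    using assms that Comp_hom[OF that(1) assms(2)] Comp_hom[OF that(2) assms(3)] hom_objs
    unfolding is_terminal_def by blast
  show ?thesis
    using homD[OF assms(2)] homD[OF assms(3)] eq
    unfolding is_product_def is_pullback_def by auto
qed

lemma product_proj2_cover:
  assumes P: "is_product C A B P p q"
  shows "q \<in> Cov"
proof -
  obtain T where T: "is_terminal C T" "\<And>X f. f \<in> hom C X T \<Longrightarrow> f \<in> Cov"
    using terminal_cover hom_objs by metis
  have "A \<in> Obj C" "B \<in> Obj C"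
    using P hom_objs unfolding is_product_def by blast+
  then obtain f g where "f \<in> hom C A T" "g \<in> hom C B T"
    using T(1) unfolding is_terminal_def by blast
  with T P show ?thesis
    using product_is_pullback pullback_cover by blast
qed

lemma is_product_swap: "is_product C A B P p q \<Longrightarrow> is_product C B A P q p"
  unfolding is_product_def by (simp add: conj_ac)

lemma product_proj1_cover: "is_product C A B P p q \<Longrightarrow> p \<in> Cov"
  using is_product_swap product_proj2_cover by blast

lemma product_exists:
  assumes "A \<in> Obj C" "B \<in> Obj C"
  shows "\<exists>P p q. is_product C A B P p q"
proof -
  obtain T where T: "is_terminal C T" "\<And>X f. f \<in> hom C X T \<Longrightarrow> f \<in> Cov"
    using terminal_cover hom_objs by metis
  obtain f g where f: "f \<in> hom C A T" and g: "g \<in> hom C B T"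
    using T(1) assms unfolding is_terminal_def by blast
  obtain P p q where "is_pullback C f g P p q"
    using pullback_exists[OF T(2)[OF f]] homD[OF f] homD[OF g] by metis
  then show ?thesis
    using product_is_pullback[OF T(1) f g] by blast
qed

lemma product_cone:
  assumes "A \<in> Obj C" "B \<in> Obj C"
  shows "is_product C A B (product_obj C A B) (proj1 C A B) (proj2 C A B)"
proof -
  have "\<exists>c. (\<lambda>(P, p, q). is_product C A B P p q) c"
    using product_exists[OF assms] by auto
  then have "(\<lambda>(P, p, q). is_product C A B P p q) (product_cone C A B)"
    unfolding product_cone_def by (rule someI_ex)
  then show ?thesis
    by (simp add: product_obj_def proj1_def proj2_def split_beta)
qed

lemma proj_hom:
  assumes "A \<in> Obj C" "B \<in> Obj C"
  shows proj1_hom: "proj1 C A B \<in> hom C (product_obj C A B) A"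
    and proj2_hom: "proj2 C A B \<in> hom C (product_obj C A B) B"
  using product_cone[OF assms] unfolding is_product_def by auto

lemma pairing:
  assumes f: "f \<in> hom C T A" and g: "g \<in> hom C T B"
  shows pairing_hom: "pairing C f g \<in> hom C T (product_obj C A B)"
    and proj1_pairing: "proj1 C A B \<cdot> pairing C f g = f"
    and proj2_pairing: "proj2 C A B \<cdot> pairing C f g = g"
proof -
  have "\<exists>!u. u \<in> hom C T (product_obj C A B) \<and> proj1 C A B \<cdot> u = f \<and> proj2 C A B \<cdot> u = g"
    using product_cone[of A B] hom_objs f g unfolding is_product_def by blast
  from theI'[OF this] have "pairing C f g \<in> hom C T (product_obj C A B) \<and>
      proj1 C A B \<cdot> pairing C f g = f \<and> proj2 C A B \<cdot> pairing C f g = g"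
    unfolding pairing_def using homD[OF f] homD[OF g] by simp
  then show "pairing C f g \<in> hom C T (product_obj C A B)"
    "proj1 C A B \<cdot> pairing C f g = f" "proj2 C A B \<cdot> pairing C f g = g" by auto
qed

lemma pairing_eqI:
  assumes "u \<in> hom C T (product_obj C A B)" "A \<in> Obj C" "B \<in> Obj C"
    and "proj1 C A B \<cdot> u = f" "proj2 C A B \<cdot> u = g"
  shows "pairing C f g = u"
proof -
  have f: "f \<in> hom C T A" and g: "g \<in> hom C T B"
    using assms proj_hom Comp_hom by blast+
  then show ?thesis
    using product_cone[OF assms(2,3)] pairing[OF f g] assms unfolding is_product_def by blast
qed

lemma pairing_comp:
  assumes "f \<in> hom C T A" "g \<in> hom C T B" "u \<in> hom C S T"
  shows "pairing C f g \<cdot> u = pairing C (f \<cdot> u) (g \<cdot> u)"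
proof (rule pairing_eqI[symmetric])
  have obj: "A \<in> Obj C" "B \<in> Obj C" using assms hom_objs by blast+
  then show "A \<in> Obj C" "B \<in> Obj C" .
  note p = pairing[OF assms(1,2)]
  show "pairing C f g \<cdot> u \<in> hom C S (product_obj C A B)"
    using p assms Comp_hom by blast
  show "proj1 C A B \<cdot> pairing C f g \<cdot> u = f \<cdot> u" "proj2 C A B \<cdot> pairing C f g \<cdot> u = g \<cdot> u"
    using Comp_assoc[OF assms(3) p(1) proj1_hom[OF obj]]
      Comp_assoc[OF assms(3) p(1) proj2_hom[OF obj]] p by auto
qed

text \<open>
  The group structure on \<open>hom C T (carr H)\<close> that a group object \<open>H\<close> induces by Yoneda. The unit
  has to be told \<open>T\<close>; product and inverse read it off their arguments.
\<close>

definition gmul :: "('o, 'a) group_data \<Rightarrow> 'a \<Rightarrow> 'a \<Rightarrow> 'a" where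
  "gmul H x y = mult H \<cdot> pairing C x y"

definition ginv :: "('o, 'a) group_data \<Rightarrow> 'a \<Rightarrow> 'a" where
  "ginv H x = invs H \<cdot> x"

definition gone :: "('o, 'a) group_data \<Rightarrow> 'o \<Rightarrow> 'a" where
  "gone H T = unt H \<cdot> to_terminal C T"

lemma group_objectD:
  assumes "group_object C H"
  shows carr_obj: "carr H \<in> Obj C"
    and mult_hom: "mult H \<in> hom C (product_obj C (carr H) (carr H)) (carr H)"
    and unt_hom: "unt H \<in> hom C (terminal_obj C) (carr H)"
    and invs_hom: "invs H \<in> hom C (carr H) (carr H)"
  using assms unfolding group_object_def Let_def by auto

lemma gmul_hom:
  "group_object C H \<Longrightarrow> x \<in> hom C T (carr H) \<Longrightarrow> y \<in> hom C T (carr H) \<Longrightarrow>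
    gmul H x y \<in> hom C T (carr H)"
  unfolding gmul_def using mult_hom pairing_hom Comp_hom by blast

lemma ginv_hom: "group_object C H \<Longrightarrow> x \<in> hom C T (carr H) \<Longrightarrow> ginv H x \<in> hom C T (carr H)"
  unfolding ginv_def using invs_hom Comp_hom by blast

lemma gone_hom: "group_object C H \<Longrightarrow> T \<in> Obj C \<Longrightarrow> gone H T \<in> hom C T (carr H)"
  unfolding gone_def using unt_hom to_terminal_hom Comp_hom by blast

lemma gmul_comp:
  assumes "group_object C H" "x \<in> hom C T (carr H)" "y \<in> hom C T (carr H)" "u \<in> hom C S T"
  shows "gmul H x y \<cdot> u = gmul H (x \<cdot> u) (y \<cdot> u)"
  unfolding gmul_def
  using Comp_assoc[OF assms(4) pairing_hom[OF assms(2,3)] mult_hom[OF assms(1)]]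
    pairing_comp[OF assms(2,3,4)] by simp

lemma gone_comp:
  assumes "group_object C H" "u \<in> hom C S T"
  shows "gone H T \<cdot> u = gone H S"
proof -
  have "T \<in> Obj C" "S \<in> Obj C" using assms hom_objs by blast+
  then have "to_terminal C T \<cdot> u = to_terminal C S"
    using to_terminal_hom to_terminal_unique Comp_hom assms(2) by blast
  then show ?thesis
    unfolding gone_def
    using Comp_assoc[OF assms(2) to_terminal_hom[OF \<open>T \<in> Obj C\<close>] unt_hom[OF assms(1)]] by simp
qed

text \<open>
  The axioms of a group object are the group laws at the generic points, that is, at the projections of
  \<open>A \<times> A \<times> A\<close> and at the identity of \<open>A\<close>. Precomposing with a tuple of points
  specializes them; this argument gives associativity here and the other laws below.
\<close>

lemma gmul_assoc:
  assumes H: "group_object C H"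
    and x: "x \<in> hom C T (carr H)" and y: "y \<in> hom C T (carr H)" and z: "z \<in> hom C T (carr H)"
  shows "gmul H (gmul H x y) z = gmul H x (gmul H y z)"
proof -
  let ?A = "carr H" let ?AA = "product_obj C ?A ?A"
  let ?x = "proj1 C ?A ?A \<cdot> proj1 C ?AA ?A"
  let ?y = "proj2 C ?A ?A \<cdot> proj1 C ?AA ?A"
  let ?z = "proj2 C ?AA ?A"
  let ?S = "product_obj C ?AA ?A"
  let ?t = "pairing C (pairing C x y) z"
  have A: "?A \<in> Obj C" using carr_obj[OF H] .
  have xy: "pairing C x y \<in> hom C T ?AA" using pairing_hom x y .
  have AA: "?AA \<in> Obj C" using xy hom_objs by blast
  have t: "?t \<in> hom C T ?S" using pairing_hom[OF xy z] .
  have p: "?x \<in> hom C ?S ?A" "?y \<in> hom C ?S ?A" "?z \<in> hom C ?S ?A"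
    using Comp_hom proj_hom A AA by blast+
  have tx: "?x \<cdot> ?t = x" and ty: "?y \<cdot> ?t = y" and tz: "?z \<cdot> ?t = z"
    using Comp_assoc[OF t proj1_hom[OF AA A] proj1_hom[OF A A]]
      Comp_assoc[OF t proj1_hom[OF AA A] proj2_hom[OF A A]]
      proj1_pairing[OF xy z] proj2_pairing[OF xy z] proj1_pairing[OF x y] proj2_pairing[OF x y]
    by simp_all
  have "gmul H (gmul H ?x ?y) ?z = gmul H ?x (gmul H ?y ?z)"
    using H unfolding group_object_def Let_def gmul_def by blast
  then have "gmul H (gmul H ?x ?y) ?z \<cdot> ?t = gmul H ?x (gmul H ?y ?z) \<cdot> ?t" by simp
  then show ?thesis
    by (simp add: gmul_comp[OF H _ _ t] gmul_hom[OF H] p tx ty tz)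
qed

lemma group_laws:
  assumes H: "group_object C H" and x: "x \<in> hom C T (carr H)"
  shows gmul_one_left: "gmul H (gone H T) x = x"
    and gmul_one_right: "gmul H x (gone H T) = x"
    and ginv_left: "gmul H (ginv H x) x = gone H T"
    and ginv_right: "gmul H x (ginv H x) = gone H T"
proof -
  let ?A = "carr H" let ?I = "Id C ?A"
  have A: "?A \<in> Obj C" using carr_obj[OF H] .
  note h = Id_hom[OF A] gone_hom[OF H A] invs_hom[OF H]
  have eqs: "gmul H (gone H ?A) ?I = ?I" "gmul H ?I (gone H ?A) = ?I"
    "gmul H (invs H) ?I = gone H ?A" "gmul H ?I (invs H) = gone H ?A"
    using H unfolding group_object_def Let_def gmul_def gone_def by blast+
  have s: "?I \<cdot> x = x" "invs H \<cdot> x = ginv H x" using Id_Comp[OF x] by (simp_all add: ginv_def)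
  show "gmul H (gone H T) x = x" "gmul H x (gone H T) = x"
    "gmul H (ginv H x) x = gone H T" "gmul H x (ginv H x) = gone H T"
    using eqs[THEN arg_cong[of _ _ "\<lambda>v. v \<cdot> x"]]
    by (simp_all add: gmul_comp[OF H _ _ x] h s gone_comp[OF H x])
qed

lemma gmul_ginv_cancel:
  assumes "group_object C H" "x \<in> hom C T (carr H)" "y \<in> hom C T (carr H)"
  shows "gmul H (ginv H x) (gmul H x y) = y" "gmul H x (gmul H (ginv H x) y) = y"
    "gmul H (gmul H x (ginv H y)) y = x" "gmul H (gmul H x y) (ginv H y) = x"
  using assms
  by (simp_all add: gmul_assoc ginv_hom gmul_one_left gmul_one_right ginv_left ginv_right
      gmul_assoc[symmetric, OF _ ginv_hom] gmul_assoc[symmetric, of H x T "ginv H x" y])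

lemma group_homD: "group_hom C H K f \<Longrightarrow> f \<in> hom C (carr H) (carr K)"
  unfolding group_hom_def by simp

lemma hom_gmul:
  assumes H: "group_object C H" and K: "group_object C K" and f: "group_hom C H K f"
    and x: "x \<in> hom C T (carr H)" and y: "y \<in> hom C T (carr H)"
  shows "f \<cdot> gmul H x y = gmul K (f \<cdot> x) (f \<cdot> y)"
proof -
  let ?A = "carr H"
  note A = carr_obj[OF H] and fh = group_homD[OF f]
  let ?p = "proj1 C ?A ?A" and ?q = "proj2 C ?A ?A" and ?t = "pairing C x y"
  note t = pairing_hom[OF x y] and p = proj1_hom[OF A A] and q = proj2_hom[OF A A]
  have "f \<cdot> gmul H x y = (f \<cdot> mult H) \<cdot> ?t"
    unfolding gmul_def using Comp_assoc[OF t mult_hom[OF H] fh] .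
  also have "f \<cdot> mult H = gmul K (f \<cdot> ?p) (f \<cdot> ?q)"
    using f unfolding group_hom_def gmul_def by simp
  also have "\<dots> \<cdot> ?t = gmul K ((f \<cdot> ?p) \<cdot> ?t) ((f \<cdot> ?q) \<cdot> ?t)"
    using gmul_comp[OF K Comp_hom[OF p fh] Comp_hom[OF q fh] t] .
  also have "\<dots> = gmul K (f \<cdot> x) (f \<cdot> y)"
    using Comp_assoc[OF t p fh] Comp_assoc[OF t q fh] proj1_pairing[OF x y] proj2_pairing[OF x y]
    by simp
  finally show ?thesis .
qed

lemma hom_ginv:
  assumes H: "group_object C H" and K: "group_object C K" and f: "group_hom C H K f"
    and x: "x \<in> hom C T (carr H)"
  shows "f \<cdot> ginv H x = ginv K (f \<cdot> x)"
proof -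
  note fh = group_homD[OF f]
  have T: "T \<in> Obj C" using x hom_objs by blast
  note e = gone_hom[OF H T] and v = ginv_hom[OF H x]
  note fe = Comp_hom[OF e fh] and fv = Comp_hom[OF v fh] and fx = Comp_hom[OF x fh]
  have "gmul K (f \<cdot> gone H T) (f \<cdot> gone H T) = f \<cdot> gone H T"
    using hom_gmul[OF H K f e e] gmul_one_left[OF H e] by simp
  \<comment> \<open>A homomorphism is only required to preserve products; it preserves the unit because the
    image of the unit is idempotent.\<close>
  then have one: "f \<cdot> gone H T = gone K T"
    using gmul_ginv_cancel(1)[OF K fe fe] ginv_left[OF K fe] by simp
  have "gmul K (f \<cdot> ginv H x) (f \<cdot> x) = gone K T"
    using hom_gmul[OF H K f v x] ginv_left[OF H x] one by simp
  then show ?thesis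
    using gmul_ginv_cancel(4)[OF K fv fx] gmul_one_left[OF K ginv_hom[OF K fx]] by simp
qed

end

section \<open>Unions of faces of a simplex\<close>

lemma Delta_hom: "\<theta> \<in> hom Delta m n \<longleftrightarrow> (\<exists>f. \<theta> = (m, n, f) \<and> f \<in> {..m} \<rightarrow>\<^sub>E {..n} \<and> mono_on {..m} f)"
  by (auto simp: hom_def Delta_def)

lemma Delta_Comp: "Comp Delta (m', n, g) (l, m, f) = (l, n, compose {..l} g f)"
  by (simp add: Delta_def)

lemma Delta_Id: "Id Delta n = (n, n, \<lambda>x\<in>{..n}. x)"
  by (simp add: Delta_def)

interpretation Delta: category Delta
proof
  fix f assume "f \<in> Arr Delta"
  then show "Dom Delta f \<in> Obj Delta" "Cod Delta f \<in> Obj Delta" by (auto simp: Delta_def)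
next
  fix A show "Id Delta A \<in> hom Delta A A"
    by (auto simp: Delta_hom Delta_Id mono_on_def)
next
  fix f g A B D assume "f \<in> hom Delta A B" "g \<in> hom Delta B D"
  then show "Comp Delta g f \<in> hom Delta A D"
    by (fastforce simp: Delta_hom Delta_Comp mono_on_def compose_def PiE_def Pi_def)
next
  fix f A B assume "f \<in> hom Delta A B"
  then show "Comp Delta f (Id Delta A) = f" "Comp Delta (Id Delta B) f = f"
    by (auto simp: Delta_hom Delta_Comp Delta_Id compose_def PiE_def Pi_def extensional_def
        intro!: ext)
next
  fix f g h A B D E assume "f \<in> hom Delta A B" "g \<in> hom Delta B D" "h \<in> hom Delta D E"
  then show "Comp Delta h (Comp Delta g f) = Comp Delta (Comp Delta h g) f"
    by (auto simp: Delta_hom Delta_Comp compose_def PiE_def Pi_def intro!: ext)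
qed

definition misses :: "delta_arr \<Rightarrow> nat \<Rightarrow> bool" where
  "misses \<sigma> j \<longleftrightarrow> j \<notin> snd (snd \<sigma>) ` {..fst \<sigma>}"

definition face_simplices :: "nat \<Rightarrow> nat set \<Rightarrow> nat \<Rightarrow> delta_arr set" where
  "face_simplices k J m = {\<sigma> \<in> hom Delta m k. \<exists>j\<in>J. misses \<sigma> j}"

text \<open>
  The union of the faces \<open>j \<in> J\<close> of \<open>\<Delta>\<^sup>k\<close>. Horns alone are not closed under
  the induction that constructs their representing objects: removing a face from a horn, or
  intersecting it with a face, yields a union of faces in general.
\<close>

definition face_union :: "nat \<Rightarrow> nat set \<Rightarrow> delta_arr sset" where
  "face_union k J = \<lparr>omap = face_simplices k J,
     amap = (\<lambda>\<theta>. (face_simplices k J (Cod Delta \<theta>), face_simplices k J (Dom Delta \<theta>),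
        \<lambda>\<sigma>\<in>face_simplices k J (Cod Delta \<theta>). Comp Delta \<sigma> \<theta>))\<rparr>"

lemma horn_face_union: "horn k i = face_union k ({..k} - {i})"
proof -
  have "horn_simplices k i = face_simplices k ({..k} - {i})"
    by (force simp: horn_simplices_def face_simplices_def misses_def Delta_hom fun_eq_iff)
  then show ?thesis by (simp add: horn_def face_union_def)
qed

lemma misses_Comp:
  "\<sigma> \<in> hom Delta m k \<Longrightarrow> \<theta> \<in> hom Delta l m \<Longrightarrow> misses \<sigma> j \<Longrightarrow> misses (Comp Delta \<sigma> \<theta>) j"
  by (fastforce simp: Delta_hom misses_def Delta_Comp compose_def PiE_def Pi_def)

lemma face_simplices_Comp:
  "\<sigma> \<in> face_simplices k J m \<Longrightarrow> \<theta> \<in> hom Delta l m \<Longrightarrow> Comp Delta \<sigma> \<theta> \<in> face_simplices k J l"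
  unfolding face_simplices_def using misses_Comp Delta.Comp_hom by blast

lemma face_simplices_hom: "\<sigma> \<in> face_simplices k J m \<Longrightarrow> \<sigma> \<in> hom Delta m k"
  by (simp add: face_simplices_def)

lemma face_simplices_mono: "J \<subseteq> J' \<Longrightarrow> face_simplices k J m \<subseteq> face_simplices k J' m"
  by (auto simp: face_simplices_def)

lemma face_simplices_insert:
  "\<sigma> \<in> face_simplices k (insert j J) m \<longleftrightarrow>
    \<sigma> \<in> face_simplices k J m \<or> \<sigma> \<in> hom Delta m k \<and> misses \<sigma> j"
  by (auto simp: face_simplices_def)

text \<open>
  A cone over the category of simplices of \<open>face_union k J\<close>, with its arrows parametrized by the larger
  simplex \<open>\<sigma>\<close> and an operator \<open>\<theta>\<close>: a \<open>T\<close>-point of \<open>hom(face_union k J, X)\<close>.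
\<close>

definition face_cone :: "('o, 'a) cat \<Rightarrow> ('o, 'a) sobj \<Rightarrow> nat \<Rightarrow> nat set \<Rightarrow>
    'o \<Rightarrow> (nat \<times> delta_arr \<Rightarrow> 'a) \<Rightarrow> bool" where
  "face_cone C X k J T q \<longleftrightarrow> T \<in> Obj C \<and>
     (\<forall>m. \<forall>\<sigma> \<in> face_simplices k J m. q (m, \<sigma>) \<in> hom C T (omap X m)) \<and>
     (\<forall>l m. \<forall>\<sigma> \<in> face_simplices k J m. \<forall>\<theta> \<in> hom Delta l m.
        Comp C (amap X \<theta>) (q (m, \<sigma>)) = q (l, Comp Delta \<sigma> \<theta>))"

lemma face_coneD:
  assumes "face_cone C X k J T q"
  shows face_cone_obj: "T \<in> Obj C"
    and face_cone_hom: "\<sigma> \<in> face_simplices k J m \<Longrightarrow> q (m, \<sigma>) \<in> hom C T (omap X m)"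
    and face_cone_act: "\<sigma> \<in> face_simplices k J m \<Longrightarrow> \<theta> \<in> hom Delta l m \<Longrightarrow>
      Comp C (amap X \<theta>) (q (m, \<sigma>)) = q (l, Comp Delta \<sigma> \<theta>)"
  using assms unfolding face_cone_def by blast+

lemma op_cat_simps:
  "Obj (op_cat J) = Obj J" "Arr (op_cat J) = Arr J" "Dom (op_cat J) = Cod J"
  "Cod (op_cat J) = Dom J" "Id (op_cat J) = Id J" "Comp (op_cat J) g f = Comp J f g"
  by (simp_all add: op_cat_def)

lemma Obj_face_union: "Obj (simplices (face_union k J)) = {(m, \<sigma>). \<sigma> \<in> face_simplices k J m}"
  by (simp add: simplices_def face_union_def)

lemma Arr_face_union:
  "Arr (simplices (face_union k J)) =
    {((l, Comp Delta \<sigma> \<theta>), \<theta>, (m, \<sigma>)) | l m \<sigma> \<theta>.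
      \<sigma> \<in> face_simplices k J m \<and> \<theta> \<in> hom Delta l m}" (is "?L = ?R")
proof (intro set_eqI iffI)
  fix u assume "u \<in> ?L"
  then show "u \<in> ?R" by (cases u) (auto simp: simplices_def face_union_def hom_def)
next
  fix u assume "u \<in> ?R"
  then obtain l m \<sigma> \<theta> where u: "u = ((l, Comp Delta \<sigma> \<theta>), \<theta>, (m, \<sigma>))"
    and *: "\<sigma> \<in> face_simplices k J m" "\<theta> \<in> hom Delta l m" by blast
  have "Cod Delta \<theta> = m" using *(2) by (simp add: hom_def)
  with * show "u \<in> ?L"
    unfolding u by (simp add: simplices_def face_union_def face_simplices_Comp)
qed

lemma is_cone_face_union:
  "is_cone (op_cat (simplices (face_union k J))) C (simplices_diagram X) T q \<longleftrightarrow>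
    face_cone C X k J T q"
proof -
  have "(\<forall>x \<in> {(m, \<sigma>). \<sigma> \<in> face_simplices k J m}. q x \<in> hom C T (omap (simplices_diagram X) x)) \<longleftrightarrow>
      (\<forall>m. \<forall>\<sigma> \<in> face_simplices k J m. q (m, \<sigma>) \<in> hom C T (omap X m))"
    by (simp add: Ball_def simplices_diagram_def split_paired_All[where 'a = nat and 'b = delta_arr]
        del: split_paired_All)
  moreover have "(\<forall>u \<in> Arr (simplices (face_union k J)).
        Comp C (amap (simplices_diagram X) u) (q (Cod (simplices (face_union k J)) u)) =
          q (Dom (simplices (face_union k J)) u)) \<longleftrightarrow>
      (\<forall>l m. \<forall>\<sigma> \<in> face_simplices k J m. \<forall>\<theta> \<in> hom Delta l m.
        Comp C (amap X \<theta>) (q (m, \<sigma>)) = q (l, Comp Delta \<sigma> \<theta>))" (is "?L \<longleftrightarrow> ?R")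
  proof
    assume ?L
    then show ?R
      unfolding Arr_face_union by (fastforce simp: simplices_def simplices_diagram_def
          simp del: split_paired_All)
  next
    assume ?R
    then show ?L
      unfolding Arr_face_union by (auto simp: simplices_def simplices_diagram_def
          simp del: split_paired_All)
  qed
  ultimately show ?thesis
    unfolding is_cone_def face_cone_def op_cat_simps Obj_face_union by argo
qed

text \<open>
  The arrow \<open>u\<close> factors the cone \<open>q\<close> through \<open>p\<close>. If \<open>p\<close> is the cone \<open>simplex_cone X\<close> below, this
  says that the \<open>k\<close>-simplex \<open>u\<close> restricts to the family \<open>q\<close> on the faces \<open>j \<in> J\<close>.
\<close>

definition mediates :: "('o, 'a) cat \<Rightarrow> nat \<Rightarrow> nat set \<Rightarrow>
    (nat \<times> delta_arr \<Rightarrow> 'a) \<Rightarrow> (nat \<times> delta_arr \<Rightarrow> 'a) \<Rightarrow> 'a \<Rightarrow> bool" where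
  "mediates C k J p q u \<longleftrightarrow>
     (\<forall>m \<sigma>. \<sigma> \<in> face_simplices k J m \<longrightarrow> Comp C (p (m, \<sigma>)) u = q (m, \<sigma>))"

definition is_face_object :: "('o, 'a) cat \<Rightarrow> ('o, 'a) sobj \<Rightarrow> nat \<Rightarrow> nat set \<Rightarrow>
    'o \<Rightarrow> (nat \<times> delta_arr \<Rightarrow> 'a) \<Rightarrow> bool" where
  "is_face_object C X k J L p \<longleftrightarrow> face_cone C X k J L p \<and>
     (\<forall>M q. face_cone C X k J M q \<longrightarrow>
        (\<exists>!u. u \<in> hom C M L \<and> mediates C k J p q u))"

definition simplex_cone :: "('o, 'a) sobj \<Rightarrow> nat \<times> delta_arr \<Rightarrow> 'a" where
  "simplex_cone X = (\<lambda>(m, \<sigma>). amap X \<sigma>)"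

lemma is_horn_object_iff:
  "is_horn_object C X k i L p \<longleftrightarrow> is_face_object C X k ({..k} - {i}) L p"
  unfolding is_horn_object_def is_hom_object_def is_limit_def is_face_object_def horn_face_union
    is_cone_face_union op_cat_simps Obj_face_union mediates_def
  by (simp add: Ball_def split_paired_All[where 'a = nat and 'b = delta_arr] del: split_paired_All)

lemma horn_map_eq:
  "horn_map C X k i L p =
    (THE u. u \<in> hom C (omap X k) L \<and> mediates C k ({..k} - {i}) p (simplex_cone X) u)"
  unfolding horn_map_def mediating_def horn_face_union op_cat_simps Obj_face_union mediates_def
    simplex_cone_def
  by (simp add: Ball_def split_paired_All[where 'a = nat and 'b = delta_arr] del: split_paired_All)

lemma mediatesD:
  "mediates C k J p q u \<Longrightarrow> \<sigma> \<in> face_simplices k J m \<Longrightarrow> Comp C (p (m, \<sigma>)) u = q (m, \<sigma>)"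
  unfolding mediates_def by blast

lemma mediates_simplex_cone:
  "mediates C k J (simplex_cone X) q u \<longleftrightarrow>
    (\<forall>m \<sigma>. \<sigma> \<in> face_simplices k J m \<longrightarrow> Comp C (amap X \<sigma>) u = q (m, \<sigma>))"
  unfolding mediates_def simplex_cone_def prod.case ..

lemma face_cone_mono: "face_cone C X k J' T q \<Longrightarrow> J \<subseteq> J' \<Longrightarrow> face_cone C X k J T q"
  unfolding face_cone_def using face_simplices_mono by blast

context category
begin

lemma face_objectD:
  assumes "is_face_object C X k J L p"
  shows face_object_cone: "face_cone C X k J L p"
    and face_object_lift: "face_cone C X k J M q \<Longrightarrow> \<exists>u\<in>hom C M L. mediates C k J p q u"
  using assms unfolding is_face_object_def by blast+

lemma face_object_ext:
  assumes L: "is_face_object C X k J L p" and M: "face_cone C X k J M q"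
    and "u \<in> hom C M L" "mediates C k J p q u"
    and "v \<in> hom C M L" "mediates C k J p q v"
  shows "u = v"
  using assms unfolding is_face_object_def by blast

end

section \<open>Sliding and deleting a vertex\<close>

text \<open>
  For \<open>j \<noteq> i\<close>, the idempotent operator on \<open>[k]\<close> that moves the vertex \<open>j\<close> one step towards \<open>i\<close> and fixes the
  other vertices; it is the composite of a degeneracy and the \<open>j\<close>-th face operator.
\<close>

definition slide :: "nat \<Rightarrow> nat \<Rightarrow> nat \<Rightarrow> delta_arr" where
  "slide k i j = (k, k, \<lambda>x\<in>{..k}. if x = j then (if j < i then Suc j else j - 1) else x)"

lemma slide_hom: "i \<le> k \<Longrightarrow> j \<le> k \<Longrightarrow> j \<noteq> i \<Longrightarrow> slide k i j \<in> hom Delta k k"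
  by (auto simp: slide_def Delta_hom mono_on_def)

lemma slide_misses: "j \<noteq> i \<Longrightarrow> misses (slide k i j) j"
  by (auto simp: slide_def misses_def)

lemma slide_fixes:
  assumes "\<sigma> \<in> hom Delta m k" "misses \<sigma> j"
  shows "Comp Delta (slide k i j) \<sigma> = \<sigma>"
proof -
  obtain f where f: "\<sigma> = (m, k, f)" "f \<in> {..m} \<rightarrow>\<^sub>E {..k}" using assms(1) by (auto simp: Delta_hom)
  have "compose {..m} (\<lambda>x\<in>{..k}. if x = j then (if j < i then Suc j else j - 1) else x) f x = f x" for x
  proof (cases "x \<le> m")
    case True
    then have "f x \<le> k" "f x \<noteq> j" using f assms(2) by (auto simp: misses_def)
    then show ?thesis using True by (simp add: compose_def)
  next
    case False
    then show ?thesis using PiE_arb[OF f(2), of x] by (simp add: compose_def)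
  qed
  then show ?thesis unfolding f(1) slide_def Delta_Comp by blast
qed

lemma slide_keeps_missing:
  assumes "\<sigma> \<in> hom Delta m k" "misses \<sigma> l" "l \<noteq> (if j < i then Suc j else j - 1)"
  shows "misses (Comp Delta (slide k i j) \<sigma>) l"
proof -
  obtain f where f: "\<sigma> = (m, k, f)" "f \<in> {..m} \<rightarrow>\<^sub>E {..k}" using assms(1) by (auto simp: Delta_hom)
  have "compose {..m} (\<lambda>x\<in>{..k}. if x = j then (if j < i then Suc j else j - 1) else x) f x \<noteq> l"
    if "x \<le> m" for x
  proof -
    have "f x \<le> k" "f x \<noteq> l" using that f assms(2) by (auto simp: misses_def)
    then show ?thesis using that assms(3) by (simp add: compose_def)
  qed
  then show ?thesis unfolding f(1) slide_def Delta_Comp misses_def snd_conv fst_conv by blast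
qed

text \<open>
  The \<open>j\<close>-th face operator \<open>coface k j\<close> enumerates the vertices other than \<open>j\<close>, by \<open>skip j\<close>. Its left
  inverse \<open>codeg k j\<close> sends \<open>j\<close> to \<open>j\<close> if \<open>j \<le> k\<close>, and to \<open>k\<close> if \<open>j = Suc k\<close>.
\<close>

definition skip :: "nat \<Rightarrow> nat \<Rightarrow> nat" where
  "skip j x = (if x < j then x else Suc x)"

definition coface :: "nat \<Rightarrow> nat \<Rightarrow> delta_arr" where
  "coface k j = (k, Suc k, \<lambda>x\<in>{..k}. skip j x)"

definition codeg :: "nat \<Rightarrow> nat \<Rightarrow> delta_arr" where
  "codeg k j = (Suc k, k, \<lambda>x\<in>{..Suc k}. if j < x then x - 1 else min x k)"

lemma skip_neq: "skip j x \<noteq> j"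
  by (simp add: skip_def)

lemma skip_eq_iff: "skip j x = skip j y \<longleftrightarrow> x = y"
  by (simp add: skip_def)

lemma skip_surj:
  assumes "i \<le> Suc k" "i \<noteq> j" "j \<le> Suc k"
  obtains x where "x \<le> k" "skip j x = i"
proof (cases "i < j")
  case True
  then show ?thesis using assms that[of i] by (simp add: skip_def)
next
  case False
  then show ?thesis using assms that[of "i - 1"] by (simp add: skip_def)
qed

lemma coface_hom: "coface k j \<in> hom Delta k (Suc k)"
  by (auto simp: coface_def skip_def Delta_hom mono_on_def)

lemma codeg_hom: "codeg k j \<in> hom Delta (Suc k) k"
  by (auto simp: codeg_def Delta_hom mono_on_def)

lemma coface_misses: "misses (coface k j) j"
  using skip_neq[of j, symmetric] by (auto simp: coface_def misses_def)

lemma codeg_coface: "j \<le> Suc k \<Longrightarrow> Comp Delta (codeg k j) (coface k j) = Id Delta k"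
  by (auto simp: codeg_def coface_def Delta_Comp Delta_Id compose_def skip_def fun_eq_iff)

lemma coface_codeg:
  assumes "\<sigma> \<in> hom Delta m (Suc k)" "misses \<sigma> j" "j \<le> Suc k"
  shows "Comp Delta (coface k j) (Comp Delta (codeg k j) \<sigma>) = \<sigma>"
proof -
  obtain f where f: "\<sigma> = (m, Suc k, f)" "f \<in> {..m} \<rightarrow>\<^sub>E {..Suc k}"
    using assms(1) by (auto simp: Delta_hom)
  have "compose {..m} (\<lambda>x\<in>{..k}. skip j x)
      (compose {..m} (\<lambda>x\<in>{..Suc k}. if j < x then x - 1 else min x k) f) x = f x" for x
  proof (cases "x \<le> m")
    case True
    then have "f x \<le> Suc k" "f x \<noteq> j" using f assms(2) by (auto simp: misses_def)
    then show ?thesis using True assms(3) by (auto simp: compose_def skip_def)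
  next
    case False
    then show ?thesis using PiE_arb[OF f(2), of x] by (simp add: compose_def)
  qed
  then show ?thesis unfolding f(1) coface_def codeg_def Delta_Comp by blast
qed

lemma misses_coface:
  assumes "\<tau> \<in> hom Delta m k"
  shows "misses (Comp Delta (coface k j) \<tau>) (skip j i) \<longleftrightarrow> misses \<tau> i"
proof -
  obtain f where f: "\<tau> = (m, k, f)" "f \<in> {..m} \<rightarrow>\<^sub>E {..k}" using assms by (auto simp: Delta_hom)
  have "compose {..m} (\<lambda>x\<in>{..k}. skip j x) f x = skip j (f x)" if "x \<le> m" for x
    using that f(2) by (auto simp: compose_def)
  then have "compose {..m} (\<lambda>x\<in>{..k}. skip j x) f ` {..m} = skip j ` f ` {..m}"
    by (force simp: image_iff)
  then show ?thesis
    unfolding f(1) coface_def Delta_Comp misses_def snd_conv fst_conv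
    by (auto simp: skip_eq_iff)
qed

text \<open>
  Under the identification of \<open>\<Delta>\<^sup>k\<close> with the \<open>j\<close>-th face of \<open>\<Delta>\<^sup>k\<^sup>+\<^sup>1\<close>, the faces
  of \<open>\<Delta>\<^sup>k\<close> that the faces \<open>J\<close> of \<open>\<Delta>\<^sup>k\<^sup>+\<^sup>1\<close> cut out.
\<close>

definition face_trace :: "nat \<Rightarrow> nat \<Rightarrow> nat set \<Rightarrow> nat set" where
  "face_trace k j J = {x. x \<le> k \<and> skip j x \<in> J}"

text \<open>
  A face outside \<open>insert j J\<close> leaves a face of the \<open>j\<close>-th face that is not in the trace. This is what keeps
  the induction on the dimension within partial boundaries.
\<close>

lemma face_trace_proper:
  assumes "insert j J \<subset> {..Suc k}"
  shows "face_trace k j J \<subset> {..k}"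
proof -
  obtain i where "i \<le> Suc k" "i \<notin> insert j J" using assms by blast
  then obtain x where "x \<le> k" "skip j x = i" using skip_surj[of i k j] assms by blast
  then show ?thesis using \<open>i \<notin> insert j J\<close> unfolding face_trace_def by blast
qed

lemma coface_face_simplices:
  assumes "insert j J \<subseteq> {..Suc k}" "j \<notin> J" and \<tau>: "\<tau> \<in> hom Delta m k"
  shows "Comp Delta (coface k j) \<tau> \<in> face_simplices (Suc k) J m \<longleftrightarrow>
    \<tau> \<in> face_simplices k (face_trace k j J) m"
proof
  assume "Comp Delta (coface k j) \<tau> \<in> face_simplices (Suc k) J m"
  then obtain i where i: "i \<in> J" "misses (Comp Delta (coface k j) \<tau>) i"
    unfolding face_simplices_def by blast
  then have "i \<le> Suc k" "i \<noteq> j" "j \<le> Suc k" using assms by blast+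
  then obtain x where "x \<le> k" "skip j x = i" by (rule skip_surj)
  then show "\<tau> \<in> face_simplices k (face_trace k j J) m"
    using i misses_coface[OF \<tau>] \<tau> unfolding face_simplices_def face_trace_def by blast
next
  assume "\<tau> \<in> face_simplices k (face_trace k j J) m"
  then show "Comp Delta (coface k j) \<tau> \<in> face_simplices (Suc k) J m"
    using misses_coface[OF \<tau>] Delta.Comp_hom[OF \<tau> coface_hom]
    unfolding face_simplices_def face_trace_def by blast
qed

section \<open>Simplicial group objects\<close>

locale simplicial_group = category_with_covers C Cov
  for C :: "('o, 'a) cat" and Cov :: "'a set" +
  fixes G :: "('o, 'a) sgrp"
  assumes simplicial_lie_group: "simplicial_lie_group C G"
begin

abbreviation X :: "('o, 'a) sobj" where
  "X \<equiv> underlying G"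

abbreviation act :: "delta_arr \<Rightarrow> 'a" where
  "act \<theta> \<equiv> amap X \<theta>"

lemma omap_X: "omap X k = carr (omap G k)"
  by (simp add: underlying_def comp_ftor_def forget_def)

lemma act_eq: "act \<theta> = snd (snd (amap G \<theta>))"
  by (simp add: underlying_def comp_ftor_def forget_def split_beta)

lemma functor_G:
  shows G_obj: "omap G k \<in> Obj (Grp C)"
    and G_hom: "\<theta> \<in> Arr Delta \<Longrightarrow>
      amap G \<theta> \<in> hom (Grp C) (omap G (Cod Delta \<theta>)) (omap G (Dom Delta \<theta>))"
    and G_Id: "amap G (Id Delta k) = Id (Grp C) (omap G k)"
    and G_Comp: "\<sigma> \<in> Arr Delta \<Longrightarrow> \<theta> \<in> Arr Delta \<Longrightarrow> Dom Delta \<sigma> = Cod Delta \<theta> \<Longrightarrow>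
      amap G (Comp Delta \<sigma> \<theta>) = Comp (Grp C) (amap G \<theta>) (amap G \<sigma>)"
proof -
  have "k \<in> Obj Delta" by (simp add: Delta_def)
  moreover have "is_functor (op_cat Delta) (Grp C) G"
    using simplicial_lie_group by (simp add: simplicial_lie_group_def simplicial_object_def)
  ultimately show "omap G k \<in> Obj (Grp C)"
    "\<theta> \<in> Arr Delta \<Longrightarrow>
      amap G \<theta> \<in> hom (Grp C) (omap G (Cod Delta \<theta>)) (omap G (Dom Delta \<theta>))"
    "amap G (Id Delta k) = Id (Grp C) (omap G k)"
    "\<sigma> \<in> Arr Delta \<Longrightarrow> \<theta> \<in> Arr Delta \<Longrightarrow> Dom Delta \<sigma> = Cod Delta \<theta> \<Longrightarrow>
      amap G (Comp Delta \<sigma> \<theta>) = Comp (Grp C) (amap G \<theta>) (amap G \<sigma>)"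
    unfolding is_functor_def op_cat_simps by simp_all
qed

lemma grp: "group_object C (omap G k)"
  using G_obj[of k] by (simp add: Grp_def)

lemma amap_G:
  assumes "\<theta> \<in> hom Delta m k"
  shows "amap G \<theta> = (omap G k, omap G m, act \<theta>)"
    and act_group_hom: "group_hom C (omap G k) (omap G m) (act \<theta>)"
  using G_hom[of \<theta>] assms by (cases "amap G \<theta>"; simp add: hom_def Grp_def act_eq)+

lemma act_hom:
  assumes "\<theta> \<in> hom Delta m k"
  shows "act \<theta> \<in> hom C (omap X k) (omap X m)"
  using group_homD[OF act_group_hom[OF assms]] by (simp add: omap_X)

lemma act_Id: "act (Id Delta k) = Id C (omap X k)"
  unfolding act_eq G_Id omap_X by (simp add: Grp_def)

lemma act_Comp:
  assumes "\<theta> \<in> hom Delta l m" "\<sigma> \<in> hom Delta m k"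
  shows "act (Comp Delta \<sigma> \<theta>) = act \<theta> \<cdot> act \<sigma>"
proof -
  have "amap G (Comp Delta \<sigma> \<theta>) = Comp (Grp C) (amap G \<theta>) (amap G \<sigma>)"
    by (rule G_Comp) (use homD[OF assms(1)] homD[OF assms(2)] in simp_all)
  then have "act (Comp Delta \<sigma> \<theta>) = snd (snd (Comp (Grp C) (amap G \<theta>) (amap G \<sigma>)))"
    by (simp only: act_eq)
  then show ?thesis
    unfolding amap_G[OF assms(1)] amap_G[OF assms(2)] by (simp add: Grp_def)
qed

lemma act_Comp_point:
  assumes "\<theta> \<in> hom Delta l m" "\<sigma> \<in> hom Delta m k" "x \<in> hom C T (omap X k)"
  shows "act (Comp Delta \<sigma> \<theta>) \<cdot> x = act \<theta> \<cdot> act \<sigma> \<cdot> x"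
  using act_Comp[OF assms(1,2)] Comp_assoc[OF assms(3) act_hom[OF assms(2)] act_hom[OF assms(1)]]
  by simp

lemma obj_X: "omap X k \<in> Obj C"
  using carr_obj[OF grp] by (simp add: omap_X)

lemma simplicial_object_X: "simplicial_object C X"
  unfolding simplicial_object_def is_functor_def op_cat_simps
proof (intro conjI ballI impI)
  fix f assume "f \<in> Arr Delta"
  then show "act f \<in> hom C (omap X (Cod Delta f)) (omap X (Dom Delta f))"
    by (intro act_hom) (simp add: hom_def)
next
  fix f g assume "f \<in> Arr Delta" "g \<in> Arr Delta" "Dom Delta f = Cod Delta g"
  then show "act (Comp Delta f g) = act g \<cdot> act f"
    by (intro act_Comp) (simp_all add: hom_def)
qed (simp_all add: obj_X act_Id)

lemma simplex_cone: "face_cone C X k J (omap X k) (simplex_cone X)"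
  unfolding face_cone_def simplex_cone_def prod.case
proof (intro conjI ballI allI)
  fix m \<sigma> assume "\<sigma> \<in> face_simplices k J m"
  from face_simplices_hom[OF this] show "act \<sigma> \<in> hom C (omap X k) (omap X m)" by (rule act_hom)
next
  fix l m \<sigma> \<theta> assume "\<sigma> \<in> face_simplices k J m" "\<theta> \<in> hom Delta l m"
  then show "act \<theta> \<cdot> act \<sigma> = act (Comp Delta \<sigma> \<theta>)"
    using act_Comp face_simplices_hom by metis
qed (rule obj_X)

lemma face_cone_comp:
  assumes q: "face_cone C X k J L q" and c: "c \<in> hom C T L"
  shows "face_cone C X k J T (\<lambda>x. q x \<cdot> c)"
  unfolding face_cone_def
proof (intro conjI allI ballI)
  show "T \<in> Obj C" using c hom_objs by blast
  fix m \<sigma> assume \<sigma>: "\<sigma> \<in> face_simplices k J m"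
  then have qh: "q (m, \<sigma>) \<in> hom C L (omap X m)" using q by (simp add: face_cone_def)
  then show "q (m, \<sigma>) \<cdot> c \<in> hom C T (omap X m)" using Comp_hom[OF c] by blast
  fix l \<theta> assume \<theta>: "\<theta> \<in> hom Delta l m"
  then have "act \<theta> \<cdot> q (m, \<sigma>) = q (l, Comp Delta \<sigma> \<theta>)" using q \<sigma> by (simp add: face_cone_def)
  then show "act \<theta> \<cdot> q (m, \<sigma>) \<cdot> c = q (l, Comp Delta \<sigma> \<theta>) \<cdot> c"
    using Comp_assoc[OF c qh act_hom[OF \<theta>]] by simp
qed

lemma face_object_jointly_monic:
  assumes L: "is_face_object C X k J L p" and c: "c \<in> hom C T L" and d: "d \<in> hom C T L"
    and eq: "\<And>m \<sigma>. \<sigma> \<in> face_simplices k J m \<Longrightarrow> p (m, \<sigma>) \<cdot> c = p (m, \<sigma>) \<cdot> d"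
  shows "c = d"
  by (rule face_object_ext[OF L face_cone_comp[OF face_object_cone[OF L] c] c _ d])
    (simp_all add: mediates_def eq)

section \<open>Filling partial boundaries\<close>

text \<open>
  Moore's filling argument, by induction on the number of faces. Suppose that \<open>w\<close> already restricts to \<open>q\<close> on
  the faces \<open>J - {j}\<close>, and let \<open>r\<close> be the operator that slides \<open>j\<close> towards a vertex \<open>i \<notin> J\<close>.
  The corrected filler is \<open>w \<cdot> (r\<^sup>* w)\<^sup>-\<^sup>1 \<cdot> q(r)\<close>, where \<open>q(r)\<close> makes sense because \<open>r\<close>
  misses \<open>j\<close>. On a simplex \<open>\<sigma>\<close> of the \<open>j\<close>-th face \<open>r \<circ> \<sigma> = \<sigma>\<close>, so the first two factors cancel
  and \<open>q(\<sigma>)\<close> is left. On a simplex that misses another \<open>l \<in> J\<close> the last two factors cancel,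
  provided that \<open>r \<circ> \<sigma>\<close> still misses \<open>l\<close>; this holds if \<open>l\<close> is not the vertex to which \<open>r\<close> moves \<open>j\<close>.
\<close>

lemma filler_exists:
  assumes "i \<le> k" "J \<subseteq> {..k} - {i}" "face_cone C X k J T q"
  shows "\<exists>w\<in>hom C T (omap X k). mediates C k J (simplex_cone X) q w"
  using assms(2,3)
proof (induction "card J" arbitrary: J)
  case 0
  then have "J = {}" using finite_subset[of J] by auto
  then have "mediates C k J (simplex_cone X) q w" for w
    by (simp add: mediates_def face_simplices_def)
  moreover have "gone (omap G k) T \<in> hom C T (omap X k)"
    using gone_hom[OF grp] 0 by (auto simp: face_cone_def omap_X)
  ultimately show ?case by blast
next
  case (Suc n)
  let ?H = "omap G k"
  \<comment> \<open>Choosing \<open>j\<close> closest to \<open>i\<close> ensures that the vertex to which it slides is not in \<open>J\<close>.\<close>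
  define d where "d x = (if x < i then i - x else x - i)" for x
  define j where "j = arg_min_on d J"
  have fin: "finite J" "J \<noteq> {}" using Suc.hyps(2) card.infinite by fastforce+
  then have j: "j \<in> J" "\<And>x. x \<in> J \<Longrightarrow> d j \<le> d x"
    using arg_min_if_finite[OF fin, of d] unfolding j_def by (auto simp: not_less)
  let ?J = "J - {j}" and ?r = "slide k i j"
  have ji: "j \<le> k" "j \<noteq> i" using j Suc.prems by auto
  have away: "l \<noteq> (if j < i then Suc j else j - 1)" if "l \<in> J" for l
    using j(2)[OF that] ji unfolding d_def by (auto split: if_splits)
  have "card ?J = n" using Suc.hyps(2) j fin by simp
  then obtain w where w: "w \<in> hom C T (omap X k)" "mediates C k ?J (simplex_cone X) q w"
    using Suc.hyps(1)[OF _ _ face_cone_mono[OF Suc.prems(2)]] Suc.prems(1) by blast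
  note r = slide_hom[OF assms(1) ji]
  have rJ: "?r \<in> face_simplices k J k"
    using r slide_misses[OF ji(2)] j(1) unfolding face_simplices_def by blast
  let ?a = "act ?r \<cdot> w" and ?b = "q (k, ?r)"
  have wH: "w \<in> hom C T (carr ?H)" using w by (simp only: omap_X)
  have aH: "?a \<in> hom C T (carr ?H)" using Comp_hom[OF w(1) act_hom[OF r]] by (simp only: omap_X)
  have bH: "?b \<in> hom C T (carr ?H)" using face_cone_hom[OF Suc.prems(2) rJ] by (simp only: omap_X)
  let ?w = "gmul ?H (gmul ?H w (ginv ?H ?a)) ?b"
  have hom: "?w \<in> hom C T (omap X k)"
    using gmul_hom[OF grp gmul_hom[OF grp wH ginv_hom[OF grp aH]] bH] by (simp only: omap_X)
  have "act \<sigma> \<cdot> ?w = q (m, \<sigma>)" if \<sigma>: "\<sigma> \<in> face_simplices k J m" for m \<sigma>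
  proof -
    let ?K = "omap G m" and ?\<rho> = "Comp Delta ?r \<sigma>"
    note \<sigma>h = face_simplices_hom[OF \<sigma>]
    have s: "act \<sigma> \<cdot> w \<in> hom C T (carr ?K)"
      using Comp_hom[OF w(1) act_hom[OF \<sigma>h]] by (simp only: omap_X)
    have sa: "act \<sigma> \<cdot> ?a = act ?\<rho> \<cdot> w" using act_Comp_point[OF \<sigma>h r w(1)] by simp
    have sb: "act \<sigma> \<cdot> ?b = q (m, ?\<rho>)" using face_cone_act[OF Suc.prems(2) rJ \<sigma>h] .
    have q: "q (m, \<sigma>) \<in> hom C T (carr ?K)" using face_cone_hom[OF Suc.prems(2) \<sigma>] by (simp only: omap_X)
    have split: "act \<sigma> \<cdot> ?w = gmul ?K (gmul ?K (act \<sigma> \<cdot> w) (ginv ?K (act ?\<rho> \<cdot> w))) (q (m, ?\<rho>))"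
      unfolding hom_gmul[OF grp grp act_group_hom[OF \<sigma>h] gmul_hom[OF grp wH ginv_hom[OF grp aH]] bH]
        hom_gmul[OF grp grp act_group_hom[OF \<sigma>h] wH ginv_hom[OF grp aH]]
        hom_ginv[OF grp grp act_group_hom[OF \<sigma>h] aH] sa sb ..
    show ?thesis
    proof (cases "misses \<sigma> j")
      case True
      then have "?\<rho> = \<sigma>" using slide_fixes[OF \<sigma>h] by blast
      then show ?thesis
        using split by (simp only: ginv_right[OF grp s] gmul_one_left[OF grp q])
    next
      case False
      then obtain l where l: "l \<in> ?J" "misses \<sigma> l" using \<sigma> unfolding face_simplices_def by blast
      then have "misses ?\<rho> l" using slide_keeps_missing[OF \<sigma>h] away by blast
      then have "\<sigma> \<in> face_simplices k ?J m" "?\<rho> \<in> face_simplices k ?J m"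
        using l \<sigma>h Delta.Comp_hom[OF \<sigma>h r] unfolding face_simplices_def by blast+
      then have sw: "act \<sigma> \<cdot> w = q (m, \<sigma>)" and rw: "act ?\<rho> \<cdot> w = q (m, ?\<rho>)"
        using w(2) unfolding mediates_simplex_cone by blast+
      have "act ?\<rho> \<cdot> w \<in> hom C T (carr ?K)"
        using Comp_hom[OF w(1) act_hom[OF Delta.Comp_hom[OF \<sigma>h r]]] by (simp only: omap_X)
      then show ?thesis
        using split unfolding sw rw by (simp only: gmul_ginv_cancel(3)[OF grp q])
    qed
  qed
  then have "mediates C k J (simplex_cone X) q ?w" unfolding mediates_simplex_cone by blast
  with hom show ?case by blast
qed

section \<open>Restriction to a partial boundary is a cover\<close>

text \<open>
  Both \<open>g = x \<cdot> s y\<close> and \<open>h \<circ> g\<close> are projections of \<open>G\<^sub>k \<times> L\<close> for a changed product structure, hence covers,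
  and cancellation gives \<open>h\<close>. The group structure of \<open>L\<close> is not constructed: the
  one product and quotient in \<open>L\<close> that occur are images under \<open>h\<close> of elements of \<open>G\<^sub>k\<close>, and equations in \<open>L\<close>
  are checked on the components of the limit cone, where they become equations in the groups \<open>G\<^sub>m\<close>.
\<close>

lemma restriction_cover:
  assumes J: "J \<subset> {..k}" and L: "is_face_object C X k J L p"
    and h: "h \<in> hom C (omap X k) L" and hp: "mediates C k J p (simplex_cone X) h"
  shows "h \<in> Cov"
proof -
  let ?H = "omap G k" let ?A = "carr ?H"
  note cone = face_object_cone[OF L]
  have h: "h \<in> hom C ?A L" using h by (simp add: omap_X)
  obtain i where i: "i \<le> k" "J \<subseteq> {..k} - {i}" using J by auto
  obtain s where s: "s \<in> hom C L ?A" "mediates C k J (simplex_cone X) p s"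
    using filler_exists[OF i cone] unfolding omap_X by blast
  have obj: "?A \<in> Obj C" "L \<in> Obj C" using hom_objs[OF h] by blast+
  obtain P a b where P: "is_product C ?A L P a b" using product_exists[OF obj] by blast
  then have a: "a \<in> hom C P ?A" and b: "b \<in> hom C P L" by (auto simp: is_product_def)
  have univ: "\<exists>!u. u \<in> hom C T P \<and> a \<cdot> u = x \<and> b \<cdot> u = y"
    if "x \<in> hom C T ?A" "y \<in> hom C T L" for T x y
    using P that unfolding is_product_def by blast
  have pL: "p (m, \<sigma>) \<in> hom C L (omap X m)" if "\<sigma> \<in> face_simplices k J m" for m \<sigma>
    using face_cone_hom[OF cone that] .
  have ph: "p (m, \<sigma>) \<cdot> h \<cdot> x = act \<sigma> \<cdot> x"
    if "\<sigma> \<in> face_simplices k J m" "x \<in> hom C T ?A" for m \<sigma> T x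
    using Comp_assoc[OF that(2) h pL[OF that(1)]] mediatesD[OF hp that(1)]
    by (simp add: simplex_cone_def)
  have act_s: "act \<sigma> \<cdot> s \<cdot> y = p (m, \<sigma>) \<cdot> y"
    if "\<sigma> \<in> face_simplices k J m" "y \<in> hom C T L" for m \<sigma> T y
    using Comp_assoc[OF that(2) s(1) group_homD[OF act_group_hom[OF face_simplices_hom[OF that(1)]]]]
      mediatesD[OF s(2) that(1)] by (simp add: simplex_cone_def)
  let ?g = "gmul ?H a (s \<cdot> b)"
  have sb: "s \<cdot> b \<in> hom C P ?A" using Comp_hom[OF b s(1)] .
  have g: "?g \<in> hom C P ?A" using gmul_hom[OF grp a sb] .
  have g_pt: "?g \<cdot> u = gmul ?H (a \<cdot> u) (s \<cdot> b \<cdot> u)" if "u \<in> hom C T P" for u T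
    using gmul_comp[OF grp a sb that] Comp_assoc[OF that b s(1)] by simp
  have "is_product C ?A L P ?g b"
    unfolding is_product_def
  proof (intro conjI allI ballI)
    fix T x y assume x: "x \<in> hom C T ?A" and y: "y \<in> hom C T L"
    have sy: "s \<cdot> y \<in> hom C T ?A" using Comp_hom[OF y s(1)] .
    let ?x = "gmul ?H x (ginv ?H (s \<cdot> y))"
    have x': "?x \<in> hom C T ?A" using gmul_hom[OF grp x ginv_hom[OF grp sy]] .
    have "?g \<cdot> u = x \<and> b \<cdot> u = y \<longleftrightarrow> a \<cdot> u = ?x \<and> b \<cdot> u = y" if u: "u \<in> hom C T P" for u
      using g_pt[OF u] gmul_ginv_cancel(3)[OF grp x sy]
        gmul_ginv_cancel(4)[OF grp Comp_hom[OF u a] sy] by auto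
    then show "\<exists>!u. u \<in> hom C T P \<and> ?g \<cdot> u = x \<and> b \<cdot> u = y"
      using univ[OF x' y] by blast
  qed (use g b in auto)
  then have g_cover: "?g \<in> Cov" using product_proj1_cover by blast
  have hg: "h \<cdot> ?g \<in> hom C P L" using Comp_hom[OF g h] .
  have "is_product C ?A L P a (h \<cdot> ?g)"
    unfolding is_product_def
  proof (intro conjI allI ballI)
    fix T x y assume x: "x \<in> hom C T ?A" and y: "y \<in> hom C T L"
    have sy: "s \<cdot> y \<in> hom C T ?A" using Comp_hom[OF y s(1)] .
    let ?z = "gmul ?H (ginv ?H x) (s \<cdot> y)"
    have z: "?z \<in> hom C T ?A" using gmul_hom[OF grp ginv_hom[OF grp x] sy] .
    \<comment> \<open>This is \<open>(h x)\<^sup>-\<^sup>1 \<cdot> y\<close>, the solution \<open>v\<close> of \<open>h x \<cdot> v = y\<close>, written with a lift of \<open>y\<close>.\<close>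
    let ?y = "h \<cdot> ?z"
    have y': "?y \<in> hom C T L" using Comp_hom[OF z h] .
    have solve: "h \<cdot> gmul ?H x (s \<cdot> v) = y \<longleftrightarrow> v = ?y" if v: "v \<in> hom C T L" for v
    proof -
      have sv: "s \<cdot> v \<in> hom C T ?A" using Comp_hom[OF v s(1)] .
      have hv: "h \<cdot> gmul ?H x (s \<cdot> v) \<in> hom C T L" using Comp_hom[OF gmul_hom[OF grp x sv] h] .
      have lhs: "p (m, \<sigma>) \<cdot> h \<cdot> gmul ?H x (s \<cdot> v) = gmul (omap G m) (act \<sigma> \<cdot> x) (p (m, \<sigma>) \<cdot> v)"
        if \<sigma>: "\<sigma> \<in> face_simplices k J m" for m \<sigma>
        using ph[OF \<sigma> gmul_hom[OF grp x sv]]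
          hom_gmul[OF grp grp act_group_hom[OF face_simplices_hom[OF \<sigma>]] x sv] act_s[OF \<sigma> v]
        by simp
      have rhs: "p (m, \<sigma>) \<cdot> ?y = gmul (omap G m) (ginv (omap G m) (act \<sigma> \<cdot> x)) (p (m, \<sigma>) \<cdot> y)"
        if \<sigma>: "\<sigma> \<in> face_simplices k J m" for m \<sigma>
        using ph[OF \<sigma> z]
          hom_gmul[OF grp grp act_group_hom[OF face_simplices_hom[OF \<sigma>]] ginv_hom[OF grp x] sy]
          hom_ginv[OF grp grp act_group_hom[OF face_simplices_hom[OF \<sigma>]] x] act_s[OF \<sigma> y]
        by simp
      have pts: "act \<sigma> \<cdot> x \<in> hom C T (carr (omap G m))" "p (m, \<sigma>) \<cdot> v \<in> hom C T (carr (omap G m))"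
        "p (m, \<sigma>) \<cdot> y \<in> hom C T (carr (omap G m))"
        if \<sigma>: "\<sigma> \<in> face_simplices k J m" for m \<sigma>
        using Comp_hom[OF x group_homD[OF act_group_hom[OF face_simplices_hom[OF \<sigma>]]]]
          Comp_hom[OF v pL[OF \<sigma>]] Comp_hom[OF y pL[OF \<sigma>]] unfolding omap_X .
      show ?thesis
      proof
        assume e: "h \<cdot> gmul ?H x (s \<cdot> v) = y"
        show "v = ?y"
          by (rule face_object_jointly_monic[OF L v y'])
            (simp only: rhs lhs[unfolded e] gmul_ginv_cancel(1)[OF grp pts(1,2)])
      next
        assume "v = ?y"
        then have rhs': "p (m, \<sigma>) \<cdot> v =
            gmul (omap G m) (ginv (omap G m) (act \<sigma> \<cdot> x)) (p (m, \<sigma>) \<cdot> y)"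
          if "\<sigma> \<in> face_simplices k J m" for m \<sigma>
          using rhs[OF that] by simp
        show "h \<cdot> gmul ?H x (s \<cdot> v) = y"
          by (rule face_object_jointly_monic[OF L hv y])
            (simp only: lhs rhs' gmul_ginv_cancel(2)[OF grp pts(1,3)])
      qed
    qed
    have "a \<cdot> u = x \<and> (h \<cdot> ?g) \<cdot> u = y \<longleftrightarrow> a \<cdot> u = x \<and> b \<cdot> u = ?y"
      if u: "u \<in> hom C T P" for u
    proof -
      have "(h \<cdot> ?g) \<cdot> u = h \<cdot> gmul ?H (a \<cdot> u) (s \<cdot> b \<cdot> u)"
        using g_pt[OF u] Comp_assoc[OF u g h] by simp
      then show ?thesis using solve[OF Comp_hom[OF u b]] by metis
    qed
    then show "\<exists>!u. u \<in> hom C T P \<and> a \<cdot> u = x \<and> (h \<cdot> ?g) \<cdot> u = y"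
      using univ[OF x y'] by blast
  qed (use a hg in auto)
  then have hg_cover: "h \<cdot> ?g \<in> Cov" using product_proj2_cover by blast
  show ?thesis
    by (rule cover_cancel[OF _ _ _ hg_cover g_cover]) (use homD[OF g] homD[OF h] in auto)
qed

section \<open>Existence of partial boundaries\<close>

lemma restriction_exists:
  assumes "is_face_object C X k J L p"
  shows "\<exists>h\<in>hom C (omap X k) L. mediates C k J p (simplex_cone X) h"
  using face_object_lift[OF assms simplex_cone] .

text \<open>
  The limit over the empty category is the terminal object.
\<close>

lemma face_object_empty: "is_face_object C X k {} (terminal_obj C) p"
proof -
  have "face_simplices k {} m = {}" for m by (simp add: face_simplices_def)
  then show ?thesis
    using terminal_obj unfolding is_face_object_def face_cone_def mediates_def is_terminal_def
    by simp
qed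

text \<open>
  A family on \<open>insert j J\<close> is a family on \<open>J\<close> together with a simplex on the \<open>j\<close>-th face, such that both agree
  where that face meets the faces \<open>J\<close>. So the new object is the pullback of
  \<open>h : X\<^sub>k \<rightarrow> L'\<close> along \<open>t : L \<rightarrow> L'\<close>, where \<open>L'\<close> represents the families on the trace of \<open>J\<close>.
\<close>

lemma face_object_insert:
  assumes jJ: "insert j J \<subset> {..Suc k}" "j \<notin> J"
    and L: "is_face_object C X (Suc k) J L p"
    and L': "is_face_object C X k (face_trace k j J) L' p'"
  shows "\<exists>P r. is_face_object C X (Suc k) (insert j J) P r"
proof -
  let ?J' = "face_trace k j J" and ?d = "coface k j" and ?s = "codeg k j"
  have j: "j \<le> Suc k" and sub: "insert j J \<subseteq> {..Suc k}" using jJ by auto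
  note d = coface_hom[of k j] and s = codeg_hom[of k j]
  note face = coface_face_simplices[OF sub jJ(2)]
  note coneL = face_object_cone[OF L] and coneL' = face_object_cone[OF L']
  obtain h where h: "h \<in> hom C (omap X k) L'" "mediates C k ?J' p' (simplex_cone X) h"
    using restriction_exists[OF L'] by blast
  have "h \<in> Cov" using restriction_cover[OF face_trace_proper[OF jJ(1)] L' h] .
  have trace_cone: "face_cone C X k ?J' T (\<lambda>(m, \<tau>). q (m, Comp Delta ?d \<tau>))"
    if q: "face_cone C X (Suc k) J T q" for T q
    unfolding face_cone_def prod.case
  proof (intro conjI allI ballI)
    show "T \<in> Obj C" using face_cone_obj[OF q] .
    fix m \<tau> assume \<tau>: "\<tau> \<in> face_simplices k ?J' m"
    note \<tau>h = face_simplices_hom[OF \<tau>]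
    have d\<tau>: "Comp Delta ?d \<tau> \<in> face_simplices (Suc k) J m" using face[OF \<tau>h] \<tau> by blast
    show "q (m, Comp Delta ?d \<tau>) \<in> hom C T (omap X m)" using face_cone_hom[OF q d\<tau>] .
    fix l \<theta> assume \<theta>: "\<theta> \<in> hom Delta l m"
    show "act \<theta> \<cdot> q (m, Comp Delta ?d \<tau>) = q (l, Comp Delta ?d (Comp Delta \<tau> \<theta>))"
      using face_cone_act[OF q d\<tau> \<theta>] Delta.Comp_assoc[OF \<theta> \<tau>h d] by simp
  qed
  obtain t where t: "t \<in> hom C L L'"
    "mediates C k ?J' p' (\<lambda>(m, \<tau>). p (m, Comp Delta ?d \<tau>)) t"
    using face_object_lift[OF L' trace_cone[OF coneL]] by blast
  obtain P a b where P: "is_pullback C h t P a b"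
    using pullback_exists[OF \<open>h \<in> Cov\<close>] homD[OF h(1)] homD[OF t(1)] by metis
  have a: "a \<in> hom C P (omap X k)" and b: "b \<in> hom C P L" and ab: "h \<cdot> a = t \<cdot> b"
    using P homD[OF h(1)] homD[OF t(1)] unfolding is_pullback_def by auto
  have univ: "\<exists>!u. u \<in> hom C T P \<and> a \<cdot> u = x \<and> b \<cdot> u = y"
    if "x \<in> hom C T (omap X k)" "y \<in> hom C T L" "h \<cdot> x = t \<cdot> y" for T x y
    using P homD[OF h(1)] homD[OF t(1)] that unfolding is_pullback_def by auto
  have p'h: "p' (m, \<tau>) \<cdot> h \<cdot> x = act \<tau> \<cdot> x"
    if "\<tau> \<in> face_simplices k ?J' m" "x \<in> hom C T (omap X k)" for m \<tau> T x
    using Comp_assoc[OF that(2) h(1) face_cone_hom[OF coneL' that(1)]] mediatesD[OF h(2) that(1)]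
    by (simp add: simplex_cone_def)
  have p't: "p' (m, \<tau>) \<cdot> t \<cdot> y = p (m, Comp Delta ?d \<tau>) \<cdot> y"
    if "\<tau> \<in> face_simplices k ?J' m" "y \<in> hom C T L" for m \<tau> T y
    using Comp_assoc[OF that(2) t(1) face_cone_hom[OF coneL' that(1)]] mediatesD[OF t(2) that(1)]
    by simp
  \<comment> \<open>A simplex may lie both on a face in \<open>J\<close> and on the \<open>j\<close>-th face; the equation \<open>h \<circ> a = t \<circ> b\<close> makes the
    two possible values agree, as \<open>r_new\<close> shows.\<close>
  define r where "r = (\<lambda>(m, \<sigma>). if \<sigma> \<in> face_simplices (Suc k) J m then p (m, \<sigma>) \<cdot> b
    else act (Comp Delta ?s \<sigma>) \<cdot> a)"
  have r_old: "r (m, \<sigma>) = p (m, \<sigma>) \<cdot> b" if "\<sigma> \<in> face_simplices (Suc k) J m" for m \<sigma>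
    using that by (simp add: r_def)
  have r_new: "r (m, \<sigma>) = act (Comp Delta ?s \<sigma>) \<cdot> a"
    if \<sigma>: "\<sigma> \<in> hom Delta m (Suc k)" "misses \<sigma> j" for m \<sigma>
  proof (cases "\<sigma> \<in> face_simplices (Suc k) J m")
    case True
    let ?\<tau> = "Comp Delta ?s \<sigma>"
    have d\<tau>: "Comp Delta ?d ?\<tau> = \<sigma>" using coface_codeg[OF \<sigma> j] .
    have \<tau>: "?\<tau> \<in> face_simplices k ?J' m"
      using face[OF Delta.Comp_hom[OF \<sigma>(1) s]] True unfolding d\<tau> by blast
    have "p (m, \<sigma>) \<cdot> b = p' (m, ?\<tau>) \<cdot> t \<cdot> b" using p't[OF \<tau> b] unfolding d\<tau> by simp
    then show ?thesis using p'h[OF \<tau> a] r_old[OF True] unfolding ab by simp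
  qed (simp add: r_def)
  have "is_face_object C X (Suc k) (insert j J) P r"
    unfolding is_face_object_def
  proof (intro conjI allI impI)
    show "face_cone C X (Suc k) (insert j J) P r"
      unfolding face_cone_def
    proof (intro conjI allI ballI)
      show "P \<in> Obj C" using hom_objs[OF a] by blast
      fix m \<sigma> assume \<sigma>: "\<sigma> \<in> face_simplices (Suc k) (insert j J) m"
      then consider (old) "\<sigma> \<in> face_simplices (Suc k) J m"
        | (new) "\<sigma> \<in> hom Delta m (Suc k)" "misses \<sigma> j"
        unfolding face_simplices_insert by blast
      then show "r (m, \<sigma>) \<in> hom C P (omap X m)"
      proof cases
        case old
        then show ?thesis
          using Comp_hom[OF b face_cone_hom[OF coneL old]] r_old by simp
      next
        case new
        then show ?thesis
          using Comp_hom[OF a act_hom[OF Delta.Comp_hom[OF new(1) s]]] r_new by simp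
      qed
      fix l \<theta> assume \<theta>: "\<theta> \<in> hom Delta l m"
      show "act \<theta> \<cdot> r (m, \<sigma>) = r (l, Comp Delta \<sigma> \<theta>)"
        using \<sigma>[unfolded face_simplices_insert]
      proof (elim disjE conjE)
        assume old: "\<sigma> \<in> face_simplices (Suc k) J m"
        show ?thesis
          unfolding r_old[OF old] r_old[OF face_simplices_Comp[OF old \<theta>]]
            face_cone_act[OF coneL old \<theta>, symmetric]
          using Comp_assoc[OF b face_cone_hom[OF coneL old] act_hom[OF \<theta>]] .
      next
        assume new: "\<sigma> \<in> hom Delta m (Suc k)" "misses \<sigma> j"
        show ?thesis
          unfolding r_new[OF new] r_new[OF Delta.Comp_hom[OF \<theta> new(1)] misses_Comp[OF new(1) \<theta> new(2)]]
            Delta.Comp_assoc[OF \<theta> new(1) s]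
          using act_Comp_point[OF \<theta> Delta.Comp_hom[OF new(1) s] a] by simp
      qed
    qed
  next
    fix T q assume q: "face_cone C X (Suc k) (insert j J) T q"
    then have qJ: "face_cone C X (Suc k) J T q" by (rule face_cone_mono) blast
    have dJ: "?d \<in> face_simplices (Suc k) (insert j J) k"
      unfolding face_simplices_insert using d coface_misses by blast
    let ?x = "q (k, ?d)"
    have x: "?x \<in> hom C T (omap X k)" using face_cone_hom[OF q dJ] .
    obtain y where y: "y \<in> hom C T L" "mediates C (Suc k) J p q y"
      using face_object_lift[OF L qJ] by blast
    have "h \<cdot> ?x = t \<cdot> y"
    proof (rule face_object_jointly_monic[OF L' Comp_hom[OF x h(1)] Comp_hom[OF y(1) t(1)]])
      fix m \<tau> assume \<tau>: "\<tau> \<in> face_simplices k ?J' m"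
      note \<tau>h = face_simplices_hom[OF \<tau>]
      have d\<tau>: "Comp Delta ?d \<tau> \<in> face_simplices (Suc k) J m" using face[OF \<tau>h] \<tau> by blast
      show "p' (m, \<tau>) \<cdot> h \<cdot> ?x = p' (m, \<tau>) \<cdot> t \<cdot> y"
        unfolding p'h[OF \<tau> x] p't[OF \<tau> y(1)] mediatesD[OF y(2) d\<tau>]
        using face_cone_act[OF q dJ \<tau>h] .
    qed
    note univ_xy = univ[OF x y(1) this]
    have "u \<in> hom C T P \<and> mediates C (Suc k) (insert j J) r q u \<longleftrightarrow>
        u \<in> hom C T P \<and> a \<cdot> u = ?x \<and> b \<cdot> u = y" for u
    proof (intro conj_cong iffI conjI)
      assume u: "u \<in> hom C T P" and res: "mediates C (Suc k) (insert j J) r q u"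
      have "r (k, ?d) = a"
        using r_new[OF d coface_misses] Id_Comp[OF a] unfolding codeg_coface[OF j] act_Id by simp
      then show "a \<cdot> u = ?x" using mediatesD[OF res dJ] by simp
      show "b \<cdot> u = y"
      proof (rule face_object_jointly_monic[OF L Comp_hom[OF u b] y(1)])
        fix m \<sigma> assume \<sigma>: "\<sigma> \<in> face_simplices (Suc k) J m"
        then have "\<sigma> \<in> face_simplices (Suc k) (insert j J) m" unfolding face_simplices_insert by blast
        then have "(p (m, \<sigma>) \<cdot> b) \<cdot> u = q (m, \<sigma>)" using mediatesD[OF res] r_old[OF \<sigma>] by metis
        then show "p (m, \<sigma>) \<cdot> b \<cdot> u = p (m, \<sigma>) \<cdot> y"
          using Comp_assoc[OF u b face_cone_hom[OF coneL \<sigma>]] mediatesD[OF y(2) \<sigma>] by simp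
      qed
    next
      assume u: "u \<in> hom C T P" and au: "a \<cdot> u = ?x \<and> b \<cdot> u = y"
      show "mediates C (Suc k) (insert j J) r q u"
        unfolding mediates_def face_simplices_insert
      proof (intro allI impI, elim disjE conjE)
        fix m \<sigma> assume \<sigma>: "\<sigma> \<in> face_simplices (Suc k) J m"
        show "r (m, \<sigma>) \<cdot> u = q (m, \<sigma>)"
          using Comp_assoc[OF u b face_cone_hom[OF coneL \<sigma>]] mediatesD[OF y(2) \<sigma>] au r_old[OF \<sigma>]
          by simp
      next
        fix m \<sigma> assume \<sigma>: "\<sigma> \<in> hom Delta m (Suc k)" "misses \<sigma> j"
        note \<tau> = Delta.Comp_hom[OF \<sigma>(1) s]
        show "r (m, \<sigma>) \<cdot> u = q (m, \<sigma>)"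
          using Comp_assoc[OF u a act_hom[OF \<tau>]] au r_new[OF \<sigma>] face_cone_act[OF q dJ \<tau>]
            coface_codeg[OF \<sigma> j] by simp
      qed
    qed blast
    then show "\<exists>!u. u \<in> hom C T P \<and> mediates C (Suc k) (insert j J) r q u"
      using univ_xy by simp
  qed
  then show ?thesis by blast
qed

lemma face_object_exists: "J \<subset> {..k} \<Longrightarrow> \<exists>L p. is_face_object C X k J L p"
proof (induction k arbitrary: J)
  case 0
  then have "J = {}" by auto
  then show ?case using face_object_empty by blast
next
  case (Suc k)
  have "finite J" using Suc.prems finite_subset[of J "{..Suc k}"] by blast
  then show ?case using Suc.prems
  proof (induction J rule: finite_induct)
    case empty
    show ?case using face_object_empty by blast
  next
    case (insert j J)
    then obtain L p where "is_face_object C X (Suc k) J L p" by blast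
    moreover obtain L' p' where "is_face_object C X k (face_trace k j J) L' p'"
      using Suc.IH[OF face_trace_proper[OF insert.prems]] by blast
    ultimately show ?case
      using face_object_insert[OF insert.prems insert.hyps(2)] by blast
  qed
qed

lemma horn_map_cover:
  assumes "i \<le> k" and L: "is_horn_object C X k i L p"
  shows "horn_map C X k i L p \<in> Cov"
proof -
  let ?J = "{..k} - {i}"
  have L: "is_face_object C X k ?J L p" using L unfolding is_horn_object_iff .
  let ?P = "\<lambda>u. u \<in> hom C (omap X k) L \<and> mediates C k ?J p (simplex_cone X) u"
  have "\<exists>!u. ?P u" using L simplex_cone unfolding is_face_object_def by blast
  then have "?P (horn_map C X k i L p)" unfolding horn_map_eq by (rule theI')
  moreover have "?J \<subset> {..k}" using assms(1) by auto
  ultimately show ?thesis using restriction_cover[OF _ L] by blast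
qed

lemma horn_object_exists: "i \<le> k \<Longrightarrow> \<exists>L p. is_horn_object C X k i L p"
  unfolding is_horn_object_iff by (rule face_object_exists) auto

end

theorem proposition6p6:
  fixes C :: "('o, 'a) cat"
    and Cov :: "'a set"
    and n :: nat
    and G :: "('o, 'a) sgrp"
  assumes "category_with_covers C Cov"
    and "n \<ge> 1"
    and "strict_lie_group C n G"
  shows "lie_groupoid C Cov (enat (n - 1)) (underlying G)"
proof -
  interpret category_with_covers C Cov by fact
  interpret simplicial_group C Cov G
    by unfold_locales (use assms(3) in \<open>simp add: strict_lie_group_def\<close>)
  have "iso C (horn_map C X k i L p)"
    if "i \<le> k" "is_horn_object C X k i L p" "enat k > enat (n - 1)" for k i L p
  proof -
    have "k \<ge> n" using that(3) assms(2) by simp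
    then show ?thesis using assms(3) that unfolding strict_lie_group_def by blast
  qed
  then show ?thesis
    unfolding lie_groupoid_def
    using simplicial_object_X horn_object_exists horn_map_cover by blast
qed

end
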